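(* Let $A,B,C,S,(M_k),\gamma,(L_k),\mu,\beta$ satisfy the standing assumption stated in the context (constant step size $\gamma>0$), and let $\varepsilon_2>0$. Let $(x_k),(y_k),(u_k)$ be generated from arbitrary $x_{-1},x_0,u_0\in\mathcal H$ by, for $k=0,1,2,\dots$, $$y_k=2x_k-x_{k-1},\qquad x_{k+1}=(M_k+A)^{-1}\big(M_kx_k-By_k-Cx_k+\gamma^{-1}u_k\big),\qquad u_{k+1}=(\gamma M_k-S)x_{k+1}-(\gamma M_k-S)x_k .$$ Assume there exists $\epsilon>0$ such that $$1-3L_k-\frac{(2+\varepsilon_2+2\varepsilon_2^2)\gamma\beta}{2\varepsilon_2}-L_{k-1}-\gamma\mu(\sqrt2+1)\ \ge\ \epsilon\quad\text{for all integers }k\ge1,$$ $$1-L_{k-1}-L_{k-2}-\gamma\mu(\sqrt2+1)\ \ge\ \epsilon\quad\text{for all integers }k\ge2 .$$ Then $(x_k)_{k\in\mathbb N}$ converges weakly to a point $x^*\in\operatorname{zer}(A+B+C)$.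
   Context: $\mathcal H$ is a real Hilbert space. $S:\mathcal H\to\mathcal H$ is (bounded) linear, self-adjoint and strongly monotone, i.e. $\langle Sx,x\rangle\ge c\|x\|^2$ for some $c>0$ and all $x$; then $S^{-1}$ has the same properties. Put $\|x\|_S^2=\langle Sx,x\rangle$ and $\|x\|_{S^{-1}}^2=\langle S^{-1}x,x\rangle$. An operator $T:\mathcal H\to\mathcal H$ is $L$-Lipschitz w.r.t. $S$ if $\|Tx-Ty\|_{S^{-1}}\le L\|x-y\|_S$ for all $x,y$; it is $\beta^{-1}$-cocoercive w.r.t. $S$ (with $\beta>0$) if $\langle Tx-Ty,x-y\rangle\ge\beta^{-1}\|Tx-Ty\|_{S^{-1}}^2$ for all $x,y$. Standing assumption: $A:\mathcal H\to2^{\mathcal H}$ is maximally monotone; $B:\mathcal H\to\mathcal H$ is single-valued, monotone and $\mu$-Lipschitz w.r.t. $S$ ($\mu>0$); $C:\mathcal H\to\mathcal H$ is $\beta^{-1}$-cocoercive w.r.t. $S$ for some $\beta>0$; $\operatorname{zer}(A+B+C)=\{x\in\mathcal H:0\in Ax+Bx+Cx\}$ is nonempty; $\gamma>0$ and, for every $k\in\mathbb N=\{0,1,2,\dots\}$, $M_k:\mathcal H\to\mathcal H$ is a (possibly nonlinear) operator such that $\gamma M_k-S$ is $L_k$-Lipschitz w.r.t. $S$ for some $L_k\in[0,1)$. Under this assumption each $(M_k+A)^{-1}$ is single-valued and defined on all of $\mathcal H$. *)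

theory Defs
  imports "HOL-Analysis.Analysis" "HOL-Library.Set_Algebras"
begin

text \<open>
  A real Hilbert space is a type of sort \<open>{real_inner, complete_space}\<close>.  A set-valued operator is
  a function \<open>'a \<Rightarrow> 'a set\<close>; a single-valued operator \<open>B\<close> is identified with \<open>\<lambda>x. {B x}\<close>.  In sums
  of set-valued operators, \<open>+\<close> is the Minkowski sum of \<open>HOL-Library.Set_Algebras\<close>.
\<close>

definition monotone_op :: "('a::real_inner \<Rightarrow> 'a set) \<Rightarrow> bool" where
  "monotone_op T \<longleftrightarrow> (\<forall>x y. \<forall>u\<in>T x. \<forall>v\<in>T y. 0 \<le> (u - v) \<bullet> (x - y))"

definition maximally_monotone :: "('a::real_inner \<Rightarrow> 'a set) \<Rightarrow> bool" where
  "maximally_monotone T \<longleftrightarrow>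
     monotone_op T \<and> (\<forall>T'. monotone_op T' \<and> (\<forall>x. T x \<subseteq> T' x) \<longrightarrow> T' = T)"

definition zer :: "('a::zero \<Rightarrow> 'a set) \<Rightarrow> 'a set" where
  "zer T = {x. 0 \<in> T x}"

definition inv_op :: "('a \<Rightarrow> 'b set) \<Rightarrow> 'b \<Rightarrow> 'a set" where
  "inv_op T u = {x. u \<in> T x}"

definition self_adjoint :: "('a::real_inner \<Rightarrow> 'a) \<Rightarrow> bool" where
  "self_adjoint S \<longleftrightarrow> (\<forall>x y. S x \<bullet> y = x \<bullet> S y)"

text \<open>Strong monotonicity is stated in the form appropriate for linear \<open>S\<close>.\<close>

definition strongly_monotone :: "('a::real_inner \<Rightarrow> 'a) \<Rightarrow> bool" where
  "strongly_monotone S \<longleftrightarrow> (\<exists>c>0. \<forall>x. c * (norm x)\<^sup>2 \<le> S x \<bullet> x)"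

definition norm_wrt :: "('a::real_inner \<Rightarrow> 'a) \<Rightarrow> 'a \<Rightarrow> real" where
  "norm_wrt S x = sqrt (S x \<bullet> x)"

text \<open>
  \<open>inv S\<close> is the genuine inverse: a bounded linear, strongly monotone \<open>S\<close> on a Hilbert space is
  bijective.
\<close>

definition lipschitz_wrt :: "('a::real_inner \<Rightarrow> 'a) \<Rightarrow> real \<Rightarrow> ('a \<Rightarrow> 'a) \<Rightarrow> bool" where
  "lipschitz_wrt S L T \<longleftrightarrow>
     (\<forall>x y. norm_wrt (inv S) (T x - T y) \<le> L * norm_wrt S (x - y))"

definition cocoercive_wrt :: "('a::real_inner \<Rightarrow> 'a) \<Rightarrow> real \<Rightarrow> ('a \<Rightarrow> 'a) \<Rightarrow> bool" where
  "cocoercive_wrt S c T \<longleftrightarrow>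
     (\<forall>x y. c * (norm_wrt (inv S) (T x - T y))\<^sup>2 \<le> (T x - T y) \<bullet> (x - y))"

definition weakly_converges :: "(nat \<Rightarrow> 'a::real_inner) \<Rightarrow> 'a \<Rightarrow> bool" where
  "weakly_converges x l \<longleftrightarrow> (\<forall>v. (\<lambda>n. x n \<bullet> v) \<longlonglongrightarrow> l \<bullet> v)"

end

theory Submission
  imports Defs
begin

text \<open>
  After scaling \<open>A\<close>, \<open>B\<close>, \<open>C\<close> by \<open>\<gamma>\<close>, the iteration says that
  \<open>S (x\<^sub>k - x\<^sub>k\<^sub>+\<^sub>1) - u\<^sub>k\<^sub>+\<^sub>1 + u\<^sub>k - B y\<^sub>k - C x\<^sub>k \<in> A x\<^sub>k\<^sub>+\<^sub>1\<close>.  Monotonicity of \<open>A\<close> is used twice, against a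
  zero and between consecutive iterates; together with Young inequalities this gives an energy that
  dominates half the squared \<open>S\<close>-distance to the zero and decreases by a multiple of the squared
  steps.  So the steps vanish, the distance to each zero converges, weak cluster points are zeros by
  demiclosedness, and Opial's argument concludes.
\<close>

section \<open>Weak cluster points\<close>

text \<open>The obstacle is \<open>B\<close>, which is merely monotone and Lipschitz and is
  evaluated at the reflected point. Pairing \<open>B y - B p\<close> with \<open>y - p\<close> has a
  sign, but the pairing that the energy requires is with the next iterate minus \<open>p\<close>.
  The discrepancy is the product of \<open>B y - B p\<close> with a second difference of the
  iterates, which is only of first order in the steps. The comparison of consecutive iterates
  through \<open>A\<close> repairs this: it supplies the same product for the previous reflected
  point, so that only the increment of \<open>B\<close> between two reflected points remains, and
  the Lipschitz bound makes that quadratic in the steps. The factor \<open>sqrt 2 + 1\<close> is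
  what results when the two Young weights in this estimate are balanced. For \<open>C\<close>, the
  coefficient in the hypothesis is \<open>\<gamma> * \<beta>\<close> times
  \<open>1 / \<epsilon>\<^sub>2 + 1 / 2 + \<epsilon>\<^sub>2\<close>, hence at least
  \<open>5 / 2\<close> times \<open>\<gamma> * \<beta>\<close>.\<close>

lemma quadratic_nonneg_discriminant:
  fixes f g h :: real
  assumes "0 \<le> h" and nonneg: "\<And>t. 0 \<le> f - 2 * t * g + t\<^sup>2 * h"
  shows "g\<^sup>2 \<le> f * h"
proof (cases "h = 0")
  case True
  have "g = 0"
  proof (rule ccontr)
    assume "g \<noteq> 0"
    \<comment> \<open>For \<open>h = 0\<close> the expression is affine in \<open>t\<close>, and
      this \<open>t\<close> gives it the value \<open>-1\<close>.\<close>
    then show False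
      using nonneg[of "(f + 1) / (2 * g)"] True by simp
  qed
  then show ?thesis using True by simp
next
  case False
  then have h: "h > 0" using assms(1) by simp
  have "0 \<le> f - g\<^sup>2 / h"
    using nonneg[of "g / h"] h by (simp add: power2_eq_square field_simps)
  then show ?thesis using h by (simp add: field_simps)
qed

text \<open>The solution minimises the quadratic functional \<open>J\<close>; strong monotonicity
  makes minimising sequences Cauchy. It serves twice: with the identity as operator it is the Riesz
  theorem, with \<open>S\<close> itself it gives the surjectivity that makes \<open>inv S\<close> a
  true inverse.\<close>

lemma symmetric_lax_milgram:
  fixes S :: "'a::{real_inner, complete_space} \<Rightarrow> 'a" and \<phi> :: "'a \<Rightarrow> real"
  assumes S: "bounded_linear S" "self_adjoint S" "strongly_monotone S" and \<phi>: "bounded_linear \<phi>"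
  obtains x where "\<And>v. S x \<bullet> v = \<phi> v"
proof -
  interpret S: bounded_linear S by fact
  interpret \<phi>: bounded_linear \<phi> by fact
  obtain c where c: "c > 0" "\<And>v. c * (norm v)\<^sup>2 \<le> S v \<bullet> v"
    using S(3) by (auto simp: strongly_monotone_def)
  obtain K where K: "\<And>v. \<bar>\<phi> v\<bar> \<le> norm v * K"
    using \<phi>.bounded by (auto simp: real_norm_def)
  have sym: "S v \<bullet> w = S w \<bullet> v" for v w
    using S(2) by (metis inner_commute self_adjoint_def)
  define J where "J v = S v \<bullet> v - 2 * \<phi> v" for v
  have J_expand: "J (v + t *\<^sub>R w) = J v + 2 * t * (S v \<bullet> w - \<phi> w) + t\<^sup>2 * (S w \<bullet> w)" for v w t
    using sym[of w v]
    by (simp add: J_def S.add S.scaleR \<phi>.add \<phi>.scaleR inner_add_left inner_add_right algebra_simps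
        power2_eq_square)
  have J_lower: "- (K\<^sup>2 / c) \<le> J v" for v
  proof -
    have "0 \<le> (c * norm v - K)\<^sup>2 / c" using c(1) by simp
    also have "\<dots> = c * (norm v)\<^sup>2 - 2 * (norm v * K) + K\<^sup>2 / c"
      using c(1) by (simp add: field_simps power2_eq_square)
    finally show ?thesis using c(2)[of v] K[of v] unfolding J_def by linarith
  qed
  define m where "m = (INF v. J v)"
  have bdd: "bdd_below (range J)" using J_lower by (auto intro!: bdd_belowI)
  have m_le: "m \<le> J v" for v unfolding m_def using bdd by (intro cINF_lower) auto
  have "\<exists>v. J v < m + inverse (real (Suc n))" for n
    using cINF_less_iff[of UNIV J "m + inverse (real (Suc n))"] bdd
    unfolding m_def by auto
  then obtain v where v: "\<And>n. J (v n) < m + inverse (real (Suc n))" by metis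
  \<comment> \<open>Parallelogram identity: the midpoint \<open>w\<close> also has value at least
    \<open>m\<close>, which forces two near-minimisers together.\<close>
  have dist_bound: "c * (norm (a - b))\<^sup>2 \<le> 2 * (J a - m) + 2 * (J b - m)" for a b
  proof -
    define s q w where "s = S b \<bullet> (a - b) - \<phi> (a - b)" and "q = S (a - b) \<bullet> (a - b)"
      and "w = b + (1/2) *\<^sub>R (a - b)"
    have "J w = J b + s + q / 4"
      unfolding w_def s_def q_def by (subst J_expand) (simp add: power2_eq_square)
    moreover have "J a = J b + 2 * s + q"
      using J_expand[of b 1 "a - b"] by (simp add: s_def q_def)
    ultimately have "q = 2 * J a + 2 * J b - 4 * J w" by simp
    then have "q \<le> 2 * (J a - m) + 2 * (J b - m)" using m_le[of w] by simp
    then show ?thesis using c(2)[of "a - b"] unfolding q_def by (rule order_trans[rotated])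
  qed
  have "Cauchy v"
  proof (rule CauchyI)
    fix e :: real assume "e > 0"
    then have "c * e\<^sup>2 / 4 > 0" using c(1) by simp
    then obtain N where N: "4 * inverse (real (Suc N)) < c * e\<^sup>2"
      using reals_Archimedean[of "c * e\<^sup>2 / 4"] by (auto simp: field_simps)
    have small: "4 * (J (v n) - m) < c * e\<^sup>2" if "n \<ge> N" for n
    proof -
      have "inverse (real (Suc n)) \<le> inverse (real (Suc N))"
        using that by (intro le_imp_inverse_le) auto
      then have "J (v n) < m + inverse (real (Suc N))"
        by (intro less_le_trans[OF v add_left_mono])
      then have "J (v n) - m < inverse (real (Suc N))" by (simp only: diff_less_eq add.commute)
      then show ?thesis using N by (meson less_trans mult_less_cancel_left_pos zero_less_numeral)
    qed
    have "norm (v i - v j) < e" if "i \<ge> N" "j \<ge> N" for i j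
    proof -
      have "c * (norm (v i - v j))\<^sup>2 < c * e\<^sup>2"
        using dist_bound[of "v i" "v j"] small[OF that(1)] small[OF that(2)] by linarith
      then show ?thesis using c(1) \<open>e > 0\<close> by (simp add: power2_less_imp_less)
    qed
    then show "\<exists>N. \<forall>i\<ge>N. \<forall>j\<ge>N. norm (v i - v j) < e" by blast
  qed
  then obtain x where x: "v \<longlonglongrightarrow> x" using Cauchy_convergent_iff convergent_def by blast
  have "(\<lambda>n. J (v n)) \<longlonglongrightarrow> J x" unfolding J_def by (intro tendsto_intros S.tendsto \<phi>.tendsto x)
  moreover have "(\<lambda>n. m + inverse (real (Suc n))) \<longlonglongrightarrow> m + 0"
    by (intro tendsto_intros LIMSEQ_inverse_real_of_nat)
  ultimately have "J x \<le> m + 0"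
    by (rule LIMSEQ_le) (use v less_imp_le in blast)
  then have min: "J x \<le> J w" for w using m_le[of w] by simp
  have "S x \<bullet> w = \<phi> w" for w
  proof -
    \<comment> \<open>The first variation vanishes: along \<open>x - t w\<close> the increment of
      \<open>J\<close> is a nonnegative quadratic in \<open>t\<close> without constant term.\<close>
    have "(S x \<bullet> w - \<phi> w)\<^sup>2 \<le> 0 * (S w \<bullet> w)"
    proof (rule quadratic_nonneg_discriminant)
      show "0 \<le> S w \<bullet> w" using c(2)[of w] c(1) by (meson order_trans mult_nonneg_nonneg less_imp_le zero_le_power2)
    next
      fix t show "0 \<le> 0 - 2 * t * (S x \<bullet> w - \<phi> w) + t\<^sup>2 * (S w \<bullet> w)"
        using min[of "x + (- t) *\<^sub>R w"] J_expand[of x "- t" w] by simp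
    qed
    then show ?thesis by simp
  qed
  then show ?thesis using that by blast
qed

lemma riesz_representation:
  fixes \<phi> :: "'a::{real_inner, complete_space} \<Rightarrow> real"
  assumes "bounded_linear \<phi>"
  obtains x where "\<And>v. x \<bullet> v = \<phi> v"
proof (rule symmetric_lax_milgram)
  show "strongly_monotone (\<lambda>v::'a. v)"
    by (auto simp: strongly_monotone_def power2_norm_eq_inner intro!: exI[of _ 1])
qed (use assms that in \<open>auto simp: self_adjoint_def bounded_linear_ident\<close>)

text \<open>Tychonoff's theorem yields a cluster point of the functionals; a filter finer than
  the given one takes the place of a weakly convergent subsequence.\<close>

lemma bounded_weak_cluster_point:
  fixes x :: "'b \<Rightarrow> 'a::{real_inner, complete_space}"
  assumes "F \<noteq> bot" and bound: "\<And>n. norm (x n) \<le> R"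
  shows "\<exists>G l. G \<le> F \<and> G \<noteq> bot \<and> (\<forall>v. ((\<lambda>n. x n \<bullet> v) \<longlongrightarrow> l \<bullet> v) G)"
proof -
  define X where "X n = (\<lambda>v::'a. x n \<bullet> v)" for n
  define P where "P = (\<Pi>\<^sub>E v\<in>(UNIV :: 'a set). {- (R * norm v) .. R * norm v})"
  have "compactin (product_topology (\<lambda>v::'a. euclidean::real topology) UNIV) P"
    unfolding P_def by (subst compactin_PiE) auto
  then have "compact P" by (simp add: euclidean_product_topology)
  have inP: "X n \<in> P" for n
  proof -
    have "\<bar>x n \<bullet> v\<bar> \<le> R * norm v" for v
      using Cauchy_Schwarz_ineq2[of "x n" v] mult_right_mono[OF bound[of n], of "norm v"] by simp
    then show ?thesis by (auto simp: P_def X_def abs_le_iff minus_le_iff)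
  qed
  have "filtermap X F \<noteq> bot" using \<open>F \<noteq> bot\<close> by (simp add: filtermap_bot_iff)
  moreover have "eventually (\<lambda>p. p \<in> P) (filtermap X F)" using inP by (simp add: eventually_filtermap)
  ultimately obtain \<phi> where \<phi>: "\<phi> \<in> P" "inf (nhds \<phi>) (filtermap X F) \<noteq> bot"
    using \<open>compact P\<close> unfolding compact_filter by blast
  \<comment> \<open>Along \<open>G\<close> the evaluations \<open>X n\<close> are forced to
    \<open>\<phi>\<close>. That \<open>G\<close> is proper restates that \<open>\<phi>\<close> is a
    cluster point of the image filter.\<close>
  define G where "G = inf F (filtercomap X (nhds \<phi>))"
  have "G \<le> F" by (simp add: G_def)
  have "G \<noteq> bot"
  proof
    assume "G = bot"
    then have "eventually (\<lambda>_. False) G" by simp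
    then obtain Q U where Q: "eventually Q F" and U: "eventually U (nhds \<phi>)"
      and QU: "\<And>n. Q n \<Longrightarrow> U (X n) \<Longrightarrow> False"
      unfolding G_def eventually_inf eventually_filtercomap by blast
    have "eventually (\<lambda>p. \<not> U p) (filtermap X F)"
      unfolding eventually_filtermap using Q by (rule eventually_mono) (use QU in blast)
    with U have "eventually (\<lambda>_. False) (inf (nhds \<phi>) (filtermap X F))"
      unfolding eventually_inf by blast
    then show False using \<phi>(2) by (simp add: trivial_limit_def)
  qed
  have "filterlim X (nhds \<phi>) G"
    by (simp add: G_def filterlim_iff_le_filtercomap)
  then have "((\<lambda>n. X n v) \<longlongrightarrow> \<phi> v) G" for v
    by (rule continuous_on_tendsto_compose[OF continuous_on_product_coordinates]) auto
  then have lim: "((\<lambda>n. x n \<bullet> v) \<longlongrightarrow> \<phi> v) G" for v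
    by (simp add: X_def)
  \<comment> \<open>Linearity survives pointwise limits along a proper filter, and membership in the
    product \<open>P\<close> is the norm bound.\<close>
  have "bounded_linear \<phi>"
  proof (rule bounded_linear_intro)
    fix v w show "\<phi> (v + w) = \<phi> v + \<phi> w"
      using tendsto_unique[OF \<open>G \<noteq> bot\<close> lim[of "v + w"]] tendsto_add[OF lim[of v] lim[of w]]
      by (simp add: inner_add_right)
  next
    fix r v show "\<phi> (r *\<^sub>R v) = r *\<^sub>R \<phi> v"
      using tendsto_unique[OF \<open>G \<noteq> bot\<close> lim[of "r *\<^sub>R v"]] tendsto_mult_left[OF lim[of v], of r]
      by simp
  next
    fix v show "norm (\<phi> v) \<le> norm v * R"
      using \<phi>(1) by (auto simp: P_def PiE_iff abs_le_iff mult.commute minus_le_iff)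
  qed
  then obtain l where "\<And>v. l \<bullet> v = \<phi> v" using riesz_representation by blast
  then show ?thesis using \<open>G \<le> F\<close> \<open>G \<noteq> bot\<close> lim by metis
qed

section \<open>Maximally monotone operators\<close>

text \<open>Adjoining the single pair \<open>(p, v)\<close> to the graph keeps it monotone, so
  maximality says that the pair was there already.\<close>

lemma maximally_monotone_memI:
  assumes "maximally_monotone A" and v: "\<And>z a. a \<in> A z \<Longrightarrow> 0 \<le> (v - a) \<bullet> (p - z)"
  shows "v \<in> A p"
proof -
  define T where "T z = (if z = p then insert v (A p) else A z)" for z
  have A: "monotone_op A" using assms(1) by (simp add: maximally_monotone_def)
  have v': "0 \<le> (a - v) \<bullet> (z - p)" if "a \<in> A z" for z a
    using v[OF that] by (simp add: inner_diff algebra_simps)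
  have "monotone_op T"
    using A v v' unfolding monotone_op_def T_def by (auto split: if_splits)
  moreover have "\<forall>z. A z \<subseteq> T z" by (auto simp: T_def)
  ultimately have "T = A" using assms(1) unfolding maximally_monotone_def by blast
  then show ?thesis by (metis T_def insertI1)
qed

text \<open>The products of the two weakly convergent sequences \<open>x\<close> and \<open>F x\<close> cancel when the monotonicity
  inequalities of \<open>A\<close> and \<open>F\<close> are added, so maximality of \<open>A + F\<close> is not needed.\<close>

lemma monotone_sum_demiclosed:
  fixes A :: "'a::real_inner \<Rightarrow> 'a set" and F :: "'a \<Rightarrow> 'a"
  assumes A: "maximally_monotone A" and F: "monotone_op (\<lambda>z. {F z})" "isCont F p"
    and G: "G \<noteq> bot" and x: "\<And>v. ((\<lambda>n. x n \<bullet> v) \<longlongrightarrow> p \<bullet> v) G"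
    and f: "\<And>v. ((\<lambda>n. F (x n) \<bullet> v) \<longlongrightarrow> f \<bullet> v) G"
    and a: "eventually (\<lambda>n. a n \<in> A (x n)) G" and r: "((\<lambda>n. a n + F (x n)) \<longlongrightarrow> 0) G"
    and bound: "\<And>n. norm (x n) \<le> R"
  shows "- F p \<in> A p"
proof -
  have monA: "monotone_op A" using A by (simp add: maximally_monotone_def)
  \<comment> \<open>The base points \<open>z\<close> for \<open>A\<close> and \<open>w\<close> for
    \<open>F\<close> are independent. Taking \<open>w = p\<close> yields
    \<open>- f \<in> A p\<close>; taking \<open>z = p\<close> with that element yields the Minty
    inequality for \<open>F\<close>. Writing \<open>a n\<close> as \<open>r' n - F (x n)\<close>
    removes the product of \<open>F (x n)\<close> with \<open>x n\<close>, so that each remaining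
    term passes to the limit.\<close>
  have key: "0 \<le> f \<bullet> (z - w) - b \<bullet> (p - z) - F w \<bullet> (p - w)" if "b \<in> A z" for z b w
  proof (rule tendsto_lowerbound[OF _ _ G])
    define r' where "r' n = a n + F (x n)" for n
    have "((\<lambda>n. norm (r' n) * (R + norm z)) \<longlongrightarrow> 0) G"
      using tendsto_mult_left_zero[OF tendsto_norm_zero[OF r]] by (simp add: r'_def)
    then have "((\<lambda>n. r' n \<bullet> (x n - z)) \<longlongrightarrow> 0) G"
    proof (rule Lim_null_comparison[rotated], intro always_eventually allI)
      fix n
      have "norm (x n - z) \<le> R + norm z"
        using norm_triangle_ineq4[of "x n" z] bound[of n] by linarith
      then show "norm (r' n \<bullet> (x n - z)) \<le> norm (r' n) * (R + norm z)"
        using Cauchy_Schwarz_ineq2[of "r' n" "x n - z"] mult_left_mono[of _ _ "norm (r' n)"]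
        by (smt (verit) norm_ge_zero real_norm_def)
    qed
    then have "((\<lambda>n. r' n \<bullet> (x n - z) + F (x n) \<bullet> (z - w) - (x n \<bullet> b - b \<bullet> z) - (x n \<bullet> F w - F w \<bullet> w))
        \<longlongrightarrow> 0 + f \<bullet> (z - w) - (p \<bullet> b - b \<bullet> z) - (p \<bullet> F w - F w \<bullet> w)) G"
      by (intro tendsto_intros x f)
    then show "((\<lambda>n. r' n \<bullet> (x n - z) + F (x n) \<bullet> (z - w) - (x n \<bullet> b - b \<bullet> z) - (x n \<bullet> F w - F w \<bullet> w))
        \<longlongrightarrow> f \<bullet> (z - w) - b \<bullet> (p - z) - F w \<bullet> (p - w)) G"
      by (simp add: inner_diff_right inner_commute)
    show "eventually (\<lambda>n. 0 \<le> r' n \<bullet> (x n - z) + F (x n) \<bullet> (z - w) - (x n \<bullet> b - b \<bullet> z)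
        - (x n \<bullet> F w - F w \<bullet> w)) G"
      using a
    proof eventually_elim
      case (elim n)
      have "0 \<le> (a n - b) \<bullet> (x n - z)" "0 \<le> (F (x n) - F w) \<bullet> (x n - w)"
        using monA F(1) elim that by (auto simp: monotone_op_def)
      then show ?case by (simp add: r'_def inner_diff inner_add_left inner_add_right inner_commute)
    qed
  qed
  have mem: "- f \<in> A p"
  proof (rule maximally_monotone_memI[OF A])
    fix z b assume "b \<in> A z"
    from key[OF this, of p] show "0 \<le> (- f - b) \<bullet> (p - z)" by (simp add: inner_diff algebra_simps)
  qed
  have minty: "0 \<le> (f - F w) \<bullet> (p - w)" for w
    using key[OF mem, of w] by (simp add: inner_diff_left)
  \<comment> \<open>Minty's device: test with \<open>w = p - t h\<close>, divide by
    \<open>t > 0\<close> and let \<open>t\<close> tend to 0. Continuity then gives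
    \<open>F p = f\<close>.\<close>
  define h where "h = F p - f"
  have "((\<lambda>t. p - t *\<^sub>R h) \<longlongrightarrow> p - 0 *\<^sub>R h) (at_right 0)" by (intro tendsto_intros)
  then have "((\<lambda>t. F (p - t *\<^sub>R h)) \<longlongrightarrow> F p) (at_right 0)"
    using isCont_tendsto_compose[OF F(2)] by simp
  then have "((\<lambda>t. (f - F (p - t *\<^sub>R h)) \<bullet> h) \<longlongrightarrow> (f - F p) \<bullet> h) (at_right (0::real))"
    by (intro tendsto_intros)
  then have "0 \<le> (f - F p) \<bullet> h"
  proof (rule tendsto_lowerbound)
    show "eventually (\<lambda>t. 0 \<le> (f - F (p - t *\<^sub>R h)) \<bullet> h) (at_right (0::real))"
      using eventually_at_right_less[of 0]
    proof eventually_elim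
      case (elim t)
      then show ?case using minty[of "p - t *\<^sub>R h"] by (simp add: zero_le_mult_iff)
    qed
  qed simp
  then have "h \<bullet> h \<le> 0" by (simp add: h_def inner_diff)
  then have "h = 0" by (metis inner_ge_zero inner_eq_zero_iff order_antisym)
  then show ?thesis using mem by (simp add: h_def)
qed

section \<open>The metric of a self-adjoint strongly monotone operator\<close>

locale metric_operator =
  fixes S :: "'a::{real_inner, complete_space} \<Rightarrow> 'a"
  assumes bounded_linear: "bounded_linear S"
    and self_adjoint: "self_adjoint S"
    and strongly_monotone: "strongly_monotone S"
begin

sublocale bounded_linear S by (fact bounded_linear)

definition sq :: "'a \<Rightarrow> real" where "sq v = S v \<bullet> v"

lemma symmetric: "S v \<bullet> w = S w \<bullet> v"
  using self_adjoint by (metis inner_commute self_adjoint_def)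

lemma coercive: "\<exists>c>0. \<forall>v. c * (norm v)\<^sup>2 \<le> sq v"
  using strongly_monotone by (simp add: strongly_monotone_def sq_def)

lemma sq_nonneg [simp]: "0 \<le> sq v"
  using coercive by (meson less_imp_le mult_nonneg_nonneg order_trans zero_le_power2)

lemma sq_eq_0_iff: "sq v = 0 \<longleftrightarrow> v = 0"
proof
  assume "sq v = 0"
  moreover obtain c where "c > 0" "c * (norm v)\<^sup>2 \<le> sq v" using coercive by blast
  ultimately have "(norm v)\<^sup>2 \<le> 0" by (simp add: mult_le_0_iff)
  then show "v = 0" by simp
qed (simp add: sq_def)

lemma sq_minus [simp]: "sq (- v) = sq v"
  by (simp add: sq_def neg)

lemma sq_scaleR: "sq (t *\<^sub>R v) = t\<^sup>2 * sq v"
  by (simp add: sq_def scaleR power2_eq_square)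

lemma sq_add: "sq (v + w) = sq v + 2 * (S v \<bullet> w) + sq w"
  using symmetric[of v w] by (simp add: sq_def add inner_add_left inner_add_right)

lemma sq_add_le:
  assumes "t > 0"
  shows "sq (v + w) \<le> (1 + t) * sq v + (1 + 1 / t) * sq w"
proof -
  have "0 \<le> sq (t *\<^sub>R v + (- w))" by simp
  then have "2 * t * (S v \<bullet> w) \<le> t\<^sup>2 * sq v + sq w"
    by (simp only: sq_add sq_scaleR sq_minus scaleR) simp
  then have "2 * (S v \<bullet> w) \<le> t * sq v + sq w / t"
    using assms by (simp add: field_simps power2_eq_square)
  then show ?thesis by (simp add: sq_add algebra_simps)
qed

section \<open>The dual norm and Young inequalities\<close>

lemma norm_wrt_nonneg [simp]: "0 \<le> norm_wrt S v"
  by (simp add: norm_wrt_def flip: sq_def)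

lemma norm_wrt_square [simp]: "(norm_wrt S v)\<^sup>2 = sq v"
  by (simp add: norm_wrt_def flip: sq_def)

text \<open>\<open>inv\<close> is only a choice function, so this needs surjectivity: solve
  \<open>S v = w\<close> weakly by Lax-Milgram.\<close>

lemma S_inv [simp]: "S (inv S w) = w"
proof (rule f_inv_into_f)
  obtain v where "\<And>y. S v \<bullet> y = w \<bullet> y"
    using symmetric_lax_milgram[OF bounded_linear self_adjoint strongly_monotone
        bounded_linear_inner_right, of w] by blast
  then have "S v = w" by (metis inner_diff_left inner_eq_zero_iff right_minus_eq)
  then show "w \<in> range S" by blast
qed

lemma norm_wrt_inv: "norm_wrt (inv S) w = norm_wrt S (inv S w)"
  by (simp add: norm_wrt_def inner_commute)

lemma norm_wrt_inv_nonneg [simp]: "0 \<le> norm_wrt (inv S) w"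
  by (simp add: norm_wrt_inv)

lemma inv_S_eq: "S v = w \<Longrightarrow> inv S w = v"
proof -
  assume "S v = w"
  then have "S (inv S w - v) = 0" by (simp add: diff)
  then have "sq (inv S w - v) = 0" by (simp add: sq_def)
  then show ?thesis by (simp add: sq_eq_0_iff)
qed

lemma norm_wrt_inv_scaleR:
  assumes "0 \<le> t"
  shows "norm_wrt (inv S) (t *\<^sub>R w) = t * norm_wrt (inv S) w"
proof -
  have "inv S (t *\<^sub>R w) = t *\<^sub>R inv S w" by (intro inv_S_eq) (simp add: scaleR)
  then show ?thesis using assms
    by (simp add: norm_wrt_def real_sqrt_mult real_sqrt_mult_self)
qed

text \<open>With \<open>w = S v'\<close>, the pairing is the \<open>S\<close>-inner product of
  \<open>v'\<close> and \<open>v\<close>, and the dual norm of \<open>w\<close> is the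
  \<open>S\<close>-norm of \<open>v'\<close>. This is therefore the usual Cauchy-Schwarz inequality
  for \<open>S\<close>.\<close>

lemma dual_cauchy_schwarz: "\<bar>w \<bullet> v\<bar> \<le> norm_wrt (inv S) w * norm_wrt S v"
proof -
  define v' where "v' = inv S w"
  have "(w \<bullet> v)\<^sup>2 \<le> sq v' * sq v"
  proof (rule quadratic_nonneg_discriminant)
    fix t
    have "0 \<le> sq (v' + (- t) *\<^sub>R v)" by simp
    then show "0 \<le> sq v' - 2 * t * (w \<bullet> v) + t\<^sup>2 * sq v"
      unfolding sq_add sq_scaleR by (simp add: v'_def)
  qed simp
  also have "\<dots> = (norm_wrt (inv S) w * norm_wrt S v)\<^sup>2"
    by (simp add: norm_wrt_inv v'_def power_mult_distrib)
  finally have "\<bar>w \<bullet> v\<bar> \<le> \<bar>norm_wrt (inv S) w * norm_wrt S v\<bar>"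
    by (simp only: abs_le_square_iff)
  then show ?thesis by simp
qed

text \<open>All Lipschitz bounds enter the energy estimates in this form. The weight
  \<open>t\<close> is free and is later taken to be 1, 2 or \<open>sqrt 2\<close>.\<close>

lemma dual_young:
  assumes w: "norm_wrt (inv S) w \<le> L * norm_wrt S d" and "0 \<le> L" "0 < t"
  shows "\<bar>2 * (w \<bullet> v)\<bar> \<le> L * (sq d / t + t * sq v)"
proof -
  define m n where "m = norm_wrt S d" and "n = norm_wrt S v"
  have "\<bar>w \<bullet> v\<bar> \<le> L * m * n"
    using dual_cauchy_schwarz[of w v] mult_right_mono[OF w, of n] by (simp add: m_def n_def)
  moreover have "2 * (m * n) \<le> m\<^sup>2 / t + t * n\<^sup>2"
  proof -
    have "0 \<le> (m - t * n)\<^sup>2 / t" using \<open>0 < t\<close> by simp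
    also have "\<dots> = m\<^sup>2 / t + t * n\<^sup>2 - 2 * (m * n)"
      using \<open>0 < t\<close> by (simp add: field_simps power2_eq_square)
    finally show ?thesis by simp
  qed
  then have "L * (2 * (m * n)) \<le> L * (m\<^sup>2 / t + t * n\<^sup>2)"
    using \<open>0 \<le> L\<close> by (rule mult_left_mono)
  ultimately show ?thesis by (simp add: m_def n_def abs_mult)
qed

text \<open>Returns from the metric norms to the ambient norm. \<open>K\<close> is chosen before
  \<open>L\<close>, so that one constant serves all the \<open>L k\<close>.\<close>

lemma norm_le_of_dual_le:
  "\<exists>K>0. \<forall>w d L. 0 \<le> L \<longrightarrow> norm_wrt (inv S) w \<le> L * norm_wrt S d \<longrightarrow> norm w \<le> K * L * norm d"
proof -
  obtain K where K: "K > 0" "\<And>v. norm (S v) \<le> norm v * K" using pos_bounded by blast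
  have N: "norm_wrt S v \<le> sqrt K * norm v" for v
  proof -
    have "sq v \<le> norm (S v) * norm v"
      unfolding sq_def by (rule norm_cauchy_schwarz)
    also have "\<dots> \<le> norm v * K * norm v" using K(2) by (rule mult_right_mono) simp
    finally have "sq v \<le> K * (norm v)\<^sup>2" by (simp add: power2_eq_square mult_ac)
    then have "sqrt (sq v) \<le> sqrt (K * (norm v)\<^sup>2)" by (rule real_sqrt_le_mono)
    then show ?thesis by (simp add: norm_wrt_def sq_def real_sqrt_mult)
  qed
  have "norm w \<le> K * L * norm d" if L: "0 \<le> L" and w: "norm_wrt (inv S) w \<le> L * norm_wrt S d" for w d L
  proof (cases "w = 0")
    case True
    then show ?thesis using K L by simp
  next
    case False
    have "norm w * norm w \<le> norm_wrt (inv S) w * norm_wrt S w"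
      using dual_cauchy_schwarz[of w w] by (simp add: dot_square_norm power2_eq_square)
    also have "\<dots> \<le> (L * norm_wrt S d) * (sqrt K * norm w)"
      by (intro mult_mono w N) (use L in auto)
    also have "\<dots> \<le> (L * (sqrt K * norm d)) * (sqrt K * norm w)"
      by (intro mult_right_mono mult_left_mono N) (use L K in auto)
    also have "\<dots> = (K * L * norm d) * norm w" using K by (simp add: mult_ac)
    finally show ?thesis using False by simp
  qed
  then show ?thesis using K(1) by blast
qed

lemma lipschitz_wrt_norm:
  assumes "lipschitz_wrt S L T" "0 \<le> L"
  shows "\<exists>K>0. \<forall>v w. norm (T v - T w) \<le> K * norm (v - w)"
proof -
  obtain K where "K > 0" and K: "\<And>w d L. 0 \<le> L \<Longrightarrow> norm_wrt (inv S) w \<le> L * norm_wrt S d \<Longrightarrow> norm w \<le> K * L * norm d"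
    using norm_le_of_dual_le by blast
  \<comment> \<open>Adding 1 keeps the constant positive even for \<open>L = 0\<close>.\<close>
  have "norm (T v - T w) \<le> (K * L + 1) * norm (v - w)" for v w
  proof -
    have "norm (T v - T w) \<le> K * L * norm (v - w)"
      using assms(1) by (intro K assms(2)) (simp add: lipschitz_wrt_def)
    also have "\<dots> \<le> (K * L + 1) * norm (v - w)" by (intro mult_right_mono) auto
    finally show ?thesis .
  qed
  then show ?thesis using \<open>K > 0\<close> assms(2) 
    by (metis add_nonneg_pos less_imp_le mult_nonneg_nonneg zero_less_one)
qed

lemma cocoercive_imp_lipschitz:
  assumes "cocoercive_wrt S (1 / \<beta>) T" "0 < \<beta>"
  shows "lipschitz_wrt S \<beta> T"
  unfolding lipschitz_wrt_def
proof (intro allI)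
  fix v w
  define n where "n = norm_wrt (inv S) (T v - T w)"
  have "1 / \<beta> * n\<^sup>2 \<le> (T v - T w) \<bullet> (v - w)"
    using assms(1) by (simp add: cocoercive_wrt_def n_def)
  also have "\<dots> \<le> n * norm_wrt S (v - w)"
    using dual_cauchy_schwarz[of "T v - T w" "v - w"] by (simp add: n_def)
  finally have "1 / \<beta> * n\<^sup>2 \<le> n * norm_wrt S (v - w)" .
  then have "n * n \<le> n * (\<beta> * norm_wrt S (v - w))"
    using \<open>0 < \<beta>\<close> by (simp add: field_simps power2_eq_square)
  moreover have "0 \<le> n" by (simp add: n_def)
  ultimately have "n = 0 \<or> n \<le> \<beta> * norm_wrt S (v - w)"
    by (auto simp: mult_le_cancel_left)
  then show "norm_wrt (inv S) (T v - T w) \<le> \<beta> * norm_wrt S (v - w)" using \<open>0 < \<beta>\<close> n_def by auto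
qed

text \<open>With \<open>m\<close> the dual norm of the increment of \<open>T\<close> and
  \<open>n\<close> the \<open>S\<close>-norm of \<open>d\<close>, cocoercivity provides
  \<open>- 2 * m\<^sup>2 / \<beta>\<close> to pay for the cross term \<open>2 * m * n\<close>. The
  maximum of the sum over \<open>m\<close> is \<open>\<beta> * n\<^sup>2 / 2\<close>.\<close>

lemma cocoercive_cross_term:
  assumes "cocoercive_wrt S (1 / \<beta>) T" "0 < \<beta>"
  shows "- 2 * ((T v - T w) \<bullet> (v - w)) - 2 * ((T v - T w) \<bullet> d) \<le> \<beta> / 2 * sq d"
proof -
  define m n where "m = norm_wrt (inv S) (T v - T w)" and "n = norm_wrt S d"
  have "m\<^sup>2 / \<beta> \<le> (T v - T w) \<bullet> (v - w)"
    using assms(1) by (simp add: cocoercive_wrt_def m_def)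
  moreover have "- ((T v - T w) \<bullet> d) \<le> m * n"
    using dual_cauchy_schwarz[of "T v - T w" d] by (simp add: m_def n_def)
  moreover have "2 * (m * n) - 2 * (m\<^sup>2 / \<beta>) \<le> \<beta> / 2 * sq d"
  proof -
    have "0 \<le> (2 * m - \<beta> * n)\<^sup>2 / (2 * \<beta>)" using \<open>0 < \<beta>\<close> by simp
    also have "\<dots> = 2 * (m\<^sup>2 / \<beta>) + \<beta> / 2 * n\<^sup>2 - 2 * (m * n)"
      using \<open>0 < \<beta>\<close> by (simp add: field_simps power2_eq_square)
    finally show ?thesis by (simp add: n_def)
  qed
  ultimately show ?thesis by linarith
qed

text \<open>Write \<open>sq (z + d1) - sq z\<close> as
  \<open>2 * (S d1 \<bullet> (z + d1)) - sq d1\<close> and replace \<open>S d1\<close> through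
  \<open>a1\<close>. The \<open>a\<close> terms on the left leave
  \<open>- 2 * (a0 \<bullet> (d1 - d0))\<close>; its part in \<open>S d0\<close> trades
  \<open>- sq d1\<close> for \<open>- sq d0 - sq (d1 - d0)\<close>, and its part in
  \<open>b'\<close> completes the increment \<open>b0 - b'\<close>.\<close>

lemma energy_identity:
  fixes z d0 d1 u0 u1 u' b0 b' c0 c' :: 'a
  defines "a1 \<equiv> - S d1 - u1 + u0 - b0 - c0" and "a0 \<equiv> - S d0 - u0 + u' - b' - c'"
  shows "sq (z + d1) - 2 * (a1 \<bullet> d1) + 2 * (u1 \<bullet> (z + d1)) - (sq z - 2 * (a0 \<bullet> d0) + 2 * (u0 \<bullet> z))
    = - 2 * (a1 \<bullet> (z + d1)) - 2 * ((a1 - a0) \<bullet> d1) - 2 * (b0 \<bullet> (z + d0)) - sq d0 - sq (d1 - d0)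
      - 2 * ((b0 - b') \<bullet> (d1 - d0)) + 2 * (u0 \<bullet> d1) + 2 * ((u0 - u') \<bullet> (d1 - d0))
      - 2 * (c0 \<bullet> (z + d1)) + 2 * (c' \<bullet> (d1 - d0))"
proof -
  have sym: "S z \<bullet> d0 = S d0 \<bullet> z" "S z \<bullet> d1 = S d1 \<bullet> z" "S d0 \<bullet> d1 = S d1 \<bullet> d0"
    by (rule symmetric)+
  show ?thesis
    unfolding a0_def a1_def sq_def
    by (simp only: add diff inner_add_left inner_add_right inner_diff_left inner_diff_right
        inner_minus_left sym) argo
qed

end

section \<open>Convergence of the scaled iteration\<close>

lemma descent_convergent:
  fixes W g :: "nat \<Rightarrow> real"
  assumes step: "\<And>k. W (Suc k) \<le> W k - \<epsilon> * g k" and "0 < \<epsilon>" and "\<And>k. 0 \<le> W k" and "\<And>k. 0 \<le> g k"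
  shows "convergent W" "g \<longlonglongrightarrow> 0"
proof -
  have "W (Suc k) \<le> W k" for k
    using step[of k] mult_nonneg_nonneg[OF less_imp_le[OF \<open>0 < \<epsilon>\<close>] assms(4)[of k]] by linarith
  then have "decseq W" by (rule decseq_SucI)
  then obtain w where w: "W \<longlonglongrightarrow> w" using decseq_convergent assms(3) by metis
  then show "convergent W" by (rule convergentI)
  have "(\<lambda>k. (W k - W (Suc k)) / \<epsilon>) \<longlonglongrightarrow> (w - w) / \<epsilon>"
    using \<open>0 < \<epsilon>\<close> by (intro tendsto_intros w LIMSEQ_Suc[OF w]) auto
  then have "(\<lambda>k. (W k - W (Suc k)) / \<epsilon>) \<longlonglongrightarrow> 0" by simp
  moreover have "norm (g k) \<le> (W k - W (Suc k)) / \<epsilon>" for k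
    using step[of k] assms(4)[of k] \<open>0 < \<epsilon>\<close> by (simp add: field_simps)
  ultimately show "g \<longlonglongrightarrow> 0" by (intro Lim_null_comparison[of g] always_eventually allI)
qed

lemma tendsto_zero_of_norm_le:
  fixes f :: "'b \<Rightarrow> 'a::real_normed_vector" and g :: "'b \<Rightarrow> 'c::real_normed_vector"
  assumes "(g \<longlongrightarrow> 0) F" "\<And>n. norm (f n) \<le> K * norm (g n)"
  shows "(f \<longlongrightarrow> 0) F"
proof (rule Lim_null_comparison)
  show "((\<lambda>n. K * norm (g n)) \<longlongrightarrow> 0) F"
    using tendsto_mult_right_zero[OF tendsto_norm_zero[OF assms(1)]] .
qed (use assms(2) in simp)

lemma tendsto_inner_bounded_zero:
  fixes f g :: "'b \<Rightarrow> 'a::real_inner"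
  assumes "(f \<longlongrightarrow> 0) F" "\<And>n. norm (g n) \<le> R"
  shows "((\<lambda>n. f n \<bullet> g n) \<longlongrightarrow> 0) F"
proof (rule tendsto_zero_of_norm_le[OF assms(1)])
  fix n
  have "\<bar>f n \<bullet> g n\<bar> \<le> norm (f n) * norm (g n)" by (rule Cauchy_Schwarz_ineq2)
  also have "\<dots> \<le> norm (f n) * R" by (intro mult_left_mono assms) simp
  finally show "norm (f n \<bullet> g n) \<le> R * norm (f n)" by (simp add: mult.commute)
qed

text \<open>Here \<open>\<gamma>\<close> is absorbed into \<open>A\<close>, \<open>B\<close>,
  \<open>C\<close>, and the kernels are eliminated: they act only through \<open>u\<close>, bounded
  by the last step. As \<open>y 0\<close> and \<open>u 0\<close> are free initial data, the
  estimates below use \<open>y\<close> and \<open>u\<close> from index 1 on.\<close>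

locale reflected_iteration = metric_operator S
  for S :: "'a::{real_inner, complete_space} \<Rightarrow> 'a" +
  fixes A :: "'a \<Rightarrow> 'a set" and B C :: "'a \<Rightarrow> 'a" and x y u :: "nat \<Rightarrow> 'a"
    and L :: "nat \<Rightarrow> real" and \<mu> \<beta> \<epsilon> :: real
  assumes maxmon_A: "maximally_monotone A"
    and mono_B: "monotone_op (\<lambda>z. {B z})" and \<mu>: "0 < \<mu>" and lip_B: "lipschitz_wrt S \<mu> B"
    and \<beta>: "0 < \<beta>" and coco_C: "cocoercive_wrt S (1 / \<beta>) C"
    and L_nonneg: "\<And>k. 0 \<le> L k"
    and u_le: "\<And>k. norm_wrt (inv S) (u (Suc k)) \<le> L k * norm_wrt S (x (Suc k) - x k)"
    and y_Suc: "\<And>k. y (Suc k) = 2 *\<^sub>R x (Suc k) - x k"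
    and inclusion: "\<And>k. S (x k - x (Suc k)) - u (Suc k) + u k - B (y k) - C (x k) \<in> A (x (Suc k))"
    and \<epsilon>: "0 < \<epsilon>"
    and parameters: "\<And>k. \<epsilon> \<le> 1 - 3 * L (Suc k) - L k - 5 / 2 * \<beta> - \<mu> * (sqrt 2 + 1)"
    and zero_exists: "\<exists>p. - (B p + C p) \<in> A p"
begin

section \<open>Differences of the iterates and the energy\<close>

definition d :: "nat \<Rightarrow> 'a" where "d k = x (Suc k) - x k"

text \<open>This is also the extrapolation error \<open>x (Suc (Suc k)) - y (Suc k)\<close>.\<close>

definition e :: "nat \<Rightarrow> 'a" where "e k = d (Suc k) - d k"

text \<open>The element of \<open>A (x (Suc k))\<close> selected by the iteration, minus
  \<open>- (B p + C p)\<close>; for a zero \<open>p\<close> it is a difference of two values of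
  \<open>A\<close>.\<close>

definition \<alpha> :: "'a \<Rightarrow> nat \<Rightarrow> 'a" where
  "\<alpha> p k = - S (d k) - u (Suc k) + u k - (B (y k) - B p) - (C (x k) - C p)"

text \<open>The cross term with \<open>\<alpha>\<close> absorbs the monotonicity of \<open>A\<close> between consecutive iterates, as
  for the projected reflected gradient method.\<close>

definition W :: "'a \<Rightarrow> nat \<Rightarrow> real" where
  "W p k = sq (x (Suc (Suc k)) - p) - 2 * (\<alpha> p (Suc k) \<bullet> d (Suc k))
     + 2 * (u (Suc (Suc k)) \<bullet> (x (Suc (Suc k)) - p)) + \<mu> * sq (e k) + L k * (sq (d k) - sq (d (Suc k)))"

lemma lip_C: "lipschitz_wrt S \<beta> C"
  using coco_C \<beta> by (rule cocoercive_imp_lipschitz)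

lemma u_young:
  "2 * (u (Suc k) \<bullet> v) \<le> L k * (sq (d k) + sq v)"
  "- 2 * (u (Suc k) \<bullet> v) \<le> L k * (sq (d k) + sq v)"
proof -
  have "\<bar>2 * (u (Suc k) \<bullet> v)\<bar> \<le> L k * (sq (d k) / 1 + 1 * sq v)"
    unfolding d_def by (rule dual_young[OF u_le L_nonneg]) simp
  then show "2 * (u (Suc k) \<bullet> v) \<le> L k * (sq (d k) + sq v)"
    "- 2 * (u (Suc k) \<bullet> v) \<le> L k * (sq (d k) + sq v)"
    by (auto simp: abs_le_iff)
qed

lemma B_young: "0 < t \<Longrightarrow> \<bar>2 * ((B v - B w) \<bullet> z)\<bar> \<le> \<mu> * (sq (v - w) / t + t * sq z)"
  using lip_B \<mu> by (intro dual_young) (auto simp: lipschitz_wrt_def)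

lemma C_young: "0 < t \<Longrightarrow> \<bar>2 * ((C v - C w) \<bullet> z)\<bar> \<le> \<beta> * (sq (v - w) / t + t * sq z)"
  using lip_C \<beta> by (intro dual_young) (auto simp: lipschitz_wrt_def)

lemma y_eq: "y (Suc k) = x (Suc k) + d k"
  by (simp add: y_Suc d_def scaleR_2)

lemma alpha_mem: "\<exists>a\<in>A (x (Suc k)). \<alpha> p k = a + (B p + C p)"
  by (rule bexI[OF _ inclusion]) (simp add: \<alpha>_def d_def diff)

lemma alpha_mono_zero:
  assumes "- (B p + C p) \<in> A p"
  shows "0 \<le> \<alpha> p k \<bullet> (x (Suc k) - p)"
proof -
  obtain a where a: "a \<in> A (x (Suc k))" "\<alpha> p k = a + (B p + C p)" using alpha_mem by blast
  have "0 \<le> (a - - (B p + C p)) \<bullet> (x (Suc k) - p)"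
    using maxmon_A a(1) assms unfolding maximally_monotone_def monotone_op_def by blast
  then show ?thesis by (simp add: a(2) algebra_simps)
qed

lemma alpha_mono_step: "0 \<le> (\<alpha> p (Suc k) - \<alpha> p k) \<bullet> d (Suc k)"
proof -
  obtain a a' where a: "a \<in> A (x (Suc (Suc k)))" "\<alpha> p (Suc k) = a + (B p + C p)"
    and a': "a' \<in> A (x (Suc k))" "\<alpha> p k = a' + (B p + C p)" using alpha_mem by meson
  have "0 \<le> (a - a') \<bullet> (x (Suc (Suc k)) - x (Suc k))"
    using maxmon_A a(1) a'(1) unfolding maximally_monotone_def monotone_op_def by blast
  then show ?thesis by (simp add: a(2) a'(2) d_def)
qed

section \<open>Descent and lower bound for the energy\<close>

lemma sqrt2_bounds: "1 \<le> sqrt 2" "sqrt 2 * sqrt 2 = 2"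
  by (auto simp: real_le_rsqrt)

lemma L_le_1: "L k \<le> 1"
proof -
  have "0 \<le> \<mu> * (sqrt 2 + 1)" using \<mu> by simp
  then show ?thesis using parameters[of k] L_nonneg[of "Suc k"] \<beta> \<epsilon> by linarith
qed

text \<open>Origin of \<open>sqrt 2 + 1\<close>. Let \<open>s\<close> be the Young weight of the
  \<open>B\<close> term and \<open>t\<close> the weight that splits the square. Coefficient 1 for
  \<open>sq (e k)\<close>, which the energy term cancels, means \<open>s = 1 + 1 / t\<close> and
  leaves \<open>t\<close> for \<open>sq (d (Suc k))\<close>. The next second difference receives
  \<open>s + 1\<close>; equating it with \<open>t\<close> gives
  \<open>s\<^sup>2 = 2\<close>.\<close>

lemma sq_reflection_le: "sq (d (Suc k) + e k) / sqrt 2 \<le> (sqrt 2 + 1) * sq (d (Suc k)) + sq (e k)"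
proof -
  have r: "1 + 1 / (1 + sqrt 2) = sqrt 2"
    using sqrt2_bounds by (simp add: divide_simps distrib_left add_nonneg_eq_0_iff)
  have "sq (d (Suc k) + e k) \<le> (1 + (1 + sqrt 2)) * sq (d (Suc k)) + (1 + 1 / (1 + sqrt 2)) * sq (e k)"
    using sqrt2_bounds(1) by (intro sq_add_le) linarith
  also have "\<dots> = sqrt 2 * ((sqrt 2 + 1) * sq (d (Suc k)) + sq (e k))"
    unfolding r using sqrt2_bounds(2) by (simp add: algebra_simps)
  finally show ?thesis using sqrt2_bounds(1) by (simp add: pos_divide_le_eq mult.commute)
qed

lemma W_descent:
  assumes p: "- (B p + C p) \<in> A p"
  shows "W p (Suc k) \<le> W p k - \<epsilon> * (sq (d (Suc k)) + sq (e (Suc k)))"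
proof -
  define z d0 d1 where "z = x (Suc (Suc k)) - p" and "d0 = d (Suc k)" and "d1 = d (Suc (Suc k))"
  define u0 u1 u' where "u0 = u (Suc (Suc k))" and "u1 = u (Suc (Suc (Suc k)))" and "u' = u (Suc k)"
  define b0 b' where "b0 = B (y (Suc (Suc k))) - B p" and "b' = B (y (Suc k)) - B p"
  define c0 c' where "c0 = C (x (Suc (Suc k))) - C p" and "c' = C (x (Suc k)) - C p"
  note defs = z_def d0_def d1_def u0_def u1_def u'_def b0_def b'_def c0_def c'_def
  define \<Delta> where "\<Delta> = sq (z + d1) - 2 * (\<alpha> p (Suc (Suc k)) \<bullet> d1) + 2 * (u1 \<bullet> (z + d1))
      - (sq z - 2 * (\<alpha> p (Suc k) \<bullet> d0) + 2 * (u0 \<bullet> z))"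
  define X D Q H where "X = sq d0" and "D = sq (d k)" and "Q = sq (e (Suc k))" and "H = sq d1"
  \<comment> \<open>Bounds for the cross terms of the identity: \<open>r1\<close> for
    \<open>B\<close>, \<open>r2\<close> to \<open>r4\<close> for \<open>u\<close>, \<open>r5\<close>
    for \<open>C\<close>.\<close>
  define r1 r2 r3 r4 r5 where "r1 = \<mu> * ((sqrt 2 + 1) * X + sq (e k)) + \<mu> * (sqrt 2 * Q)"
    and "r2 = L (Suc k) * (X + H)" and "r3 = L (Suc k) * (X + Q)" and "r4 = L k * (D + Q)"
    and "r5 = \<beta> / 2 * X + \<beta> * (X + Q)"
  note r_defs = r1_def r2_def r3_def r4_def r5_def
  have z1: "x (Suc (Suc (Suc k))) - p = z + d1" by (simp add: z_def d1_def d_def)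
  have e1: "e (Suc k) = d1 - d0" by (simp add: e_def d0_def d1_def)
  have "\<Delta>
    = - 2 * (\<alpha> p (Suc (Suc k)) \<bullet> (z + d1)) - 2 * ((\<alpha> p (Suc (Suc k)) - \<alpha> p (Suc k)) \<bullet> d1)
      - 2 * (b0 \<bullet> (z + d0)) - X - Q
      - 2 * ((b0 - b') \<bullet> (d1 - d0)) + 2 * (u0 \<bullet> d1) + 2 * ((u0 - u') \<bullet> (d1 - d0))
      - 2 * (c0 \<bullet> (z + d1)) + 2 * (c' \<bullet> (d1 - d0))"
    unfolding \<Delta>_def \<alpha>_def X_def Q_def e1 defs by (rule energy_identity)
  moreover have "0 \<le> \<alpha> p (Suc (Suc k)) \<bullet> (z + d1)"
    using alpha_mono_zero[OF p, of "Suc (Suc k)"] by (simp add: z1)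
  moreover have "0 \<le> (\<alpha> p (Suc (Suc k)) - \<alpha> p (Suc k)) \<bullet> d1"
    unfolding d1_def by (rule alpha_mono_step)
  moreover have "0 \<le> b0 \<bullet> (z + d0)"
  proof -
    have "z + d0 = y (Suc (Suc k)) - p" by (simp add: y_eq z_def d0_def)
    then show ?thesis using mono_B by (simp add: b0_def monotone_op_def)
  qed
  moreover have "- 2 * ((b0 - b') \<bullet> (d1 - d0)) \<le> r1"
  proof -
    have "b0 - b' = B (y (Suc (Suc k))) - B (y (Suc k))" by (simp add: b0_def b'_def)
    moreover have "y (Suc (Suc k)) - y (Suc k) = d (Suc k) + e k"
      by (simp add: y_eq e_def d_def)
    ultimately have "- 2 * ((b0 - b') \<bullet> (d1 - d0)) \<le> \<mu> * (sq (d (Suc k) + e k) / sqrt 2 + sqrt 2 * Q)"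
      using abs_le_D2[OF B_young[of "sqrt 2" "y (Suc (Suc k))" "y (Suc k)" "d1 - d0"]] by (simp add: Q_def e1)
    also have "\<dots> \<le> \<mu> * (((sqrt 2 + 1) * X + sq (e k)) + sqrt 2 * Q)"
      unfolding X_def d0_def using \<mu> by (intro mult_left_mono add_right_mono sq_reflection_le) auto
    finally show ?thesis by (simp add: distrib_left r1_def)
  qed
  moreover have "2 * (u0 \<bullet> d1) \<le> r2"
    unfolding u0_def X_def H_def d0_def r2_def by (rule u_young)
  moreover have "2 * (u0 \<bullet> (d1 - d0)) \<le> r3"
    unfolding u0_def X_def Q_def e1 d0_def r3_def by (rule u_young)
  moreover have "- 2 * (u' \<bullet> (d1 - d0)) \<le> r4"
    unfolding u'_def D_def Q_def e1 r4_def by (rule u_young)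
  moreover have "- 2 * (c0 \<bullet> (z + d1)) + 2 * (c' \<bullet> (d1 - d0)) \<le> r5"
  proof -
    \<comment> \<open>\<open>C\<close> is evaluated at the iterate rather than at the reflected
      point, so \<open>c0\<close> matches \<open>z\<close> and not \<open>z + d0\<close>.
      Cocoercivity pays for the excess \<open>d0\<close>, the Lipschitz bound for the increment
      \<open>c0 - c'\<close>.\<close>
    have "- 2 * (c0 \<bullet> (z + d1)) + 2 * (c' \<bullet> (d1 - d0))
        = (- 2 * (c0 \<bullet> z) - 2 * (c0 \<bullet> d0)) + - 2 * ((c0 - c') \<bullet> (d1 - d0))"
      by (simp add: inner_diff inner_add_right)
    also have "\<dots> \<le> \<beta> / 2 * X + \<beta> * (X + Q)"
    proof (rule add_mono)
      show "- 2 * (c0 \<bullet> z) - 2 * (c0 \<bullet> d0) \<le> \<beta> / 2 * X"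
        unfolding c0_def z_def X_def by (rule cocoercive_cross_term[OF coco_C \<beta>])
      show "- 2 * ((c0 - c') \<bullet> (d1 - d0)) \<le> \<beta> * (X + Q)"
        using abs_le_D2[OF C_young[of 1 "x (Suc (Suc k))" "x (Suc k)" "d1 - d0"]]
        by (simp add: c0_def c'_def X_def Q_def e1 d0_def d_def)
    qed
    finally show ?thesis by (simp add: r5_def)
  qed
  moreover have "2 * ((u0 - u') \<bullet> (d1 - d0)) = 2 * (u0 \<bullet> (d1 - d0)) + - 2 * (u' \<bullet> (d1 - d0))"
    by (simp add: inner_diff_left)
  ultimately have "\<Delta> \<le> - X - Q + r1 + r2 + r3 + r4 + r5"
    by linarith
  moreover have "W p (Suc k) - W p k
    = \<Delta> + (\<mu> * Q + L (Suc k) * (X - H) - \<mu> * sq (e k) - L k * (D - X))"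
    unfolding W_def z1 by (simp add: \<Delta>_def defs X_def D_def Q_def H_def)
  ultimately have "W p (Suc k) - W p k
    \<le> (- X - Q + r1 + r2 + r3 + r4 + r5) + (\<mu> * Q + L (Suc k) * (X - H) - \<mu> * sq (e k) - L k * (D - X))"
    by (simp only: add_le_cancel_right)
  \<comment> \<open>The last two energy terms telescope: \<open>\<mu> * sq (e k)\<close> cancels
    against \<open>r1\<close>, \<open>L k * D\<close> against \<open>r4\<close>, and
    \<open>L (Suc k) * H\<close> against \<open>r2\<close>. Only multiples of \<open>X\<close> and
    \<open>Q\<close> are left.\<close>
  also have "\<dots> = - ((1 - 3 * L (Suc k) - L k - 3 / 2 * \<beta> - \<mu> * (sqrt 2 + 1)) * X)
      - (1 - L (Suc k) - L k - \<beta> - \<mu> * (sqrt 2 + 1)) * Q"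
    unfolding r_defs by (simp add: algebra_simps)
  also have "\<dots> \<le> - (\<epsilon> * X) - \<epsilon> * Q"
  proof -
    have "\<epsilon> \<le> 1 - 3 * L (Suc k) - L k - 3 / 2 * \<beta> - \<mu> * (sqrt 2 + 1)"
      "\<epsilon> \<le> 1 - L (Suc k) - L k - \<beta> - \<mu> * (sqrt 2 + 1)"
      using parameters[of k] L_nonneg[of "Suc k"] \<beta> by linarith+
    then show ?thesis
      by (intro diff_mono le_imp_neg_le mult_right_mono) (auto simp: X_def Q_def)
  qed
  finally have "W p (Suc k) - W p k \<le> - (\<epsilon> * (X + Q))" by (simp add: distrib_left)
  then show ?thesis by (simp add: X_def Q_def d0_def)
qed

text \<open>The cross terms of \<open>W\<close> have no sign. Expanding \<open>\<alpha>\<close>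
  turns its product with the step into \<open>2 * H\<close> and further products, which Young
  charges to \<open>H\<close> and to less than the whole of \<open>X\<close>.\<close>

lemma W_lower: "sq (x (Suc (Suc k)) - p) / 2 \<le> W p k"
proof -
  define z d0 where "z = x (Suc (Suc k)) - p" and "d0 = d (Suc k)"
  define u0 u' where "u0 = u (Suc (Suc k))" and "u' = u (Suc k)"
  define b' c' where "b' = B (y (Suc k)) - B p" and "c' = C (x (Suc k)) - C p"
  define X D Q H l l' where "X = sq z" and "D = sq (d k)" and "Q = sq (e k)" and "H = sq d0"
    and "l = L (Suc k)" and "l' = L k"
  define r1 r2 r3 r4 r5 where "r1 = l * (H + X)" and "r2 = l * (H + H)" and "r3 = l' * (D + H)"
    and "r4 = \<mu> * (X + Q + 2 * H)" and "r5 = \<beta> * (X + 3 * H)"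
  note r_defs = r1_def r2_def r3_def r4_def r5_def
  have "\<alpha> p (Suc k) \<bullet> d0 = - H - u0 \<bullet> d0 + u' \<bullet> d0 - b' \<bullet> d0 - c' \<bullet> d0"
  proof -
    have "\<alpha> p (Suc k) = - S d0 - u0 + u' - b' - c'"
      unfolding \<alpha>_def d0_def u0_def u'_def b'_def c'_def ..
    then show ?thesis
      by (simp only: H_def sq_def inner_diff_left inner_add_left inner_minus_left)
  qed
  moreover have "W p k = X - 2 * (\<alpha> p (Suc k) \<bullet> d0) + 2 * (u0 \<bullet> z) + (\<mu> * Q + l' * (D - H))"
    by (simp add: W_def X_def D_def Q_def H_def d0_def u0_def z_def l'_def)
  moreover have "- 2 * (u0 \<bullet> z) \<le> r1"
    unfolding u0_def X_def H_def d0_def l_def r1_def by (rule u_young)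
  moreover have "- 2 * (u0 \<bullet> d0) \<le> r2"
    unfolding u0_def H_def d0_def l_def r2_def by (rule u_young)
  moreover have "2 * (u' \<bullet> d0) \<le> r3"
    unfolding u'_def D_def H_def d0_def l'_def r3_def by (rule u_young)
  moreover have "- 2 * (b' \<bullet> d0) \<le> r4"
  proof -
    have "y (Suc k) - p = z + (- e k)"
      unfolding y_eq z_def e_def d_def by (simp add: algebra_simps)
    \<comment> \<open>The Young weight 2 undoes the factor 2 of this splitting, so that
      \<open>\<mu> * Q\<close> is cancelled exactly by the term of \<open>W\<close>.\<close>
    then have "sq (y (Suc k) - p) \<le> 2 * X + 2 * Q"
      using sq_add_le[of 1 z "- e k"] by (simp add: X_def Q_def)
    then have "\<mu> * (sq (y (Suc k) - p) / 2 + 2 * H) \<le> \<mu> * (X + Q + 2 * H)"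
      using \<mu> by (intro mult_left_mono) auto
    then show ?thesis
      using abs_le_D2[OF B_young[of 2 "y (Suc k)" p d0]] by (simp add: b'_def H_def r4_def)
  qed
  moreover have "- 2 * (c' \<bullet> d0) \<le> r5"
  proof -
    have "x (Suc k) - p = z + (- d0)" by (simp add: z_def d0_def d_def)
    then have "sq (x (Suc k) - p) \<le> 2 * X + 2 * H"
      using sq_add_le[of 1 z "- d0"] by (simp add: X_def H_def)
    then have "\<beta> * (sq (x (Suc k) - p) / 2 + 2 * H) \<le> \<beta> * (X + 3 * H)"
      using \<beta> by (intro mult_left_mono) auto
    then show ?thesis
      using abs_le_D2[OF C_young[of 2 "x (Suc k)" p d0]] by (simp add: c'_def H_def r5_def)
  qed
  ultimately have "X + 2 * H - r1 - r2 - r3 - r4 - r5 + (\<mu> * Q + l' * (D - H)) \<le> W p k"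
    by linarith
  also have "X + 2 * H - r1 - r2 - r3 - r4 - r5 + (\<mu> * Q + l' * (D - H))
    = (1 - l - \<mu> - \<beta>) * X + (2 - 3 * l - 2 * l' - 2 * \<mu> - 3 * \<beta>) * H"
    unfolding r_defs by (simp add: algebra_simps)
  finally have "(1 - l - \<mu> - \<beta>) * X + (2 - 3 * l - 2 * l' - 2 * \<mu> - 3 * \<beta>) * H \<le> W p k" .
  \<comment> \<open>Keeping half of \<open>X\<close> costs \<open>2 * \<beta>\<close> after
    doubling, against \<open>3 / 2 * \<beta>\<close> in the descent; \<open>5 / 2 * \<beta>\<close>
    covers both.\<close>
  moreover have "\<mu> * 2 \<le> \<mu> * (sqrt 2 + 1)" using \<mu> sqrt2_bounds(1) by (intro mult_left_mono) auto
  then have "1 / 2 \<le> 1 - l - \<mu> - \<beta>" "0 \<le> 2 - 3 * l - 2 * l' - 2 * \<mu> - 3 * \<beta>"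
    using parameters[of k] L_nonneg[of k] L_nonneg[of "Suc k"] \<mu> \<beta> \<epsilon> unfolding l_def l'_def by linarith+
  then have "1 / 2 * X \<le> (1 - l - \<mu> - \<beta>) * X" "0 \<le> (2 - 3 * l - 2 * l' - 2 * \<mu> - 3 * \<beta>) * H"
    unfolding X_def H_def using sq_nonneg by (blast intro: mult_right_mono mult_nonneg_nonneg)+
  ultimately show ?thesis unfolding z_def[symmetric] X_def[symmetric] by linarith
qed

section \<open>Vanishing steps and identification of the weak limit\<close>

lemma d_tendsto_zero: "d \<longlonglongrightarrow> 0"
proof -
  obtain p where p: "- (B p + C p) \<in> A p" using zero_exists by blast
  obtain c where c: "c > 0" "\<And>v. c * (norm v)\<^sup>2 \<le> sq v" using coercive by blast
  have "0 \<le> W p k" for k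
    by (rule order_trans[OF _ W_lower]) simp
  then have "(\<lambda>k. sq (d (Suc k)) + sq (e (Suc k))) \<longlonglongrightarrow> 0"
    using W_descent[OF p] \<epsilon> by (intro descent_convergent(2)[of "W p" \<epsilon>]) auto
  then have "(\<lambda>k. (sq (d (Suc k)) + sq (e (Suc k))) / c) \<longlonglongrightarrow> 0"
    by (rule tendsto_divide_zero)
  moreover have "norm ((norm (d (Suc k)))\<^sup>2) \<le> (sq (d (Suc k)) + sq (e (Suc k))) / c" for k
  proof -
    have "c * (norm (d (Suc k)))\<^sup>2 \<le> sq (d (Suc k)) + sq (e (Suc k))"
      using c(2)[of "d (Suc k)"] sq_nonneg[of "e (Suc k)"] by linarith
    then show ?thesis using c(1) by (simp add: pos_le_divide_eq mult.commute)
  qed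
  ultimately have "(\<lambda>k. (norm (d (Suc k)))\<^sup>2) \<longlonglongrightarrow> 0"
    by (intro Lim_null_comparison[of "\<lambda>k. (norm (d (Suc k)))\<^sup>2"] always_eventually allI)
  then have "(\<lambda>k. d (Suc k)) \<longlonglongrightarrow> 0"
    by (simp add: tendsto_norm_zero_iff)
  then show ?thesis by (rule LIMSEQ_imp_Suc)
qed

lemma e_tendsto_zero: "e \<longlonglongrightarrow> 0"
  using tendsto_diff[OF LIMSEQ_Suc[OF d_tendsto_zero] d_tendsto_zero] by (simp add: e_def[abs_def])

lemma u_tendsto_zero: "u \<longlonglongrightarrow> 0"
proof -
  obtain K where "K > 0"
    and K: "\<And>w v L. 0 \<le> L \<Longrightarrow> norm_wrt (inv S) w \<le> L * norm_wrt S v \<Longrightarrow> norm w \<le> K * L * norm v"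
    using norm_le_of_dual_le by blast
  have "norm (u (Suc k)) \<le> K * norm (d k)" for k
  proof -
    have "norm (u (Suc k)) \<le> K * L k * norm (d k)"
      using u_le[of k] by (intro K L_nonneg) (simp add: d_def)
    also have "\<dots> \<le> K * 1 * norm (d k)"
      using \<open>K > 0\<close> L_le_1[of k] by (intro mult_right_mono mult_left_mono) auto
    finally show ?thesis by simp
  qed
  then have "(\<lambda>k. u (Suc k)) \<longlonglongrightarrow> 0"
    by (rule tendsto_zero_of_norm_le[OF d_tendsto_zero])
  then show ?thesis by (rule LIMSEQ_imp_Suc)
qed

lemma x_bounded: "\<exists>R. \<forall>k. norm (x k) \<le> R"
proof -
  obtain p where p: "- (B p + C p) \<in> A p" using zero_exists by blast
  obtain c where c: "c > 0" "\<And>v. c * (norm v)\<^sup>2 \<le> sq v" using coercive by blast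
  have "decseq (W p)"
  proof (rule decseq_SucI)
    fix k
    have "0 \<le> \<epsilon> * (sq (d (Suc k)) + sq (e (Suc k)))" using \<epsilon> by simp
    then show "W p (Suc k) \<le> W p k" using W_descent[OF p, of k] by linarith
  qed
  have "norm (x (Suc (Suc k)) - p) \<le> sqrt (2 * W p 0 / c)" for k
  proof -
    have "W p k \<le> W p 0" using \<open>decseq (W p)\<close> by (simp add: decseqD)
    then have "c * (norm (x (Suc (Suc k)) - p))\<^sup>2 \<le> 2 * W p 0"
      using W_lower[of k p] c(2)[of "x (Suc (Suc k)) - p"] by linarith
    then have "(norm (x (Suc (Suc k)) - p))\<^sup>2 \<le> 2 * W p 0 / c"
      using c(1) by (simp add: pos_le_divide_eq mult.commute)
    then show ?thesis by (rule real_le_rsqrt)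
  qed
  then have "norm (x (Suc (Suc k))) \<le> sqrt (2 * W p 0 / c) + norm p" for k
    using norm_triangle_ineq2[of "x (Suc (Suc k))" p] by (meson diff_le_eq order_trans)
  then have "Bseq (\<lambda>k. x (k + 2))" by (intro BseqI') simp
  then have "Bseq x" by (rule Bseq_offset)
  then show ?thesis by (meson Bseq_def)
qed

text \<open>The energy converges, and all its terms except the squared distance vanish: each has a
  factor tending to zero, and the other factors stay bounded.\<close>

lemma sq_distance_convergent:
  assumes p: "- (B p + C p) \<in> A p"
  shows "convergent (\<lambda>k. sq (x k - p))"
proof -
  obtain R where R: "\<And>k. norm (x k) \<le> R" using x_bounded by blast
  have zR: "norm (x k - p) \<le> R + norm p" for k
    using norm_triangle_ineq4[of "x k" p] R[of k] by linarith
  obtain KB where KB: "\<And>v w. norm (B v - B w) \<le> KB * norm (v - w)" "KB > 0"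
    using lipschitz_wrt_norm[OF lip_B] \<mu> by (meson less_imp_le)
  obtain KC where KC: "\<And>v w. norm (C v - C w) \<le> KC * norm (v - w)" "KC > 0"
    using lipschitz_wrt_norm[OF lip_C] \<beta> by (meson less_imp_le)
  have sq0: "(\<lambda>k. sq (f k)) \<longlonglongrightarrow> 0" if "f \<longlonglongrightarrow> 0" for f :: "nat \<Rightarrow> 'a"
  proof -
    have "(\<lambda>k. S (f k) \<bullet> f k) \<longlonglongrightarrow> S 0 \<bullet> 0" by (intro tendsto_intros tendsto that)
    then show ?thesis by (simp add: sq_def)
  qed
  have d1: "(\<lambda>k. d (Suc k)) \<longlonglongrightarrow> 0" using d_tendsto_zero by (rule LIMSEQ_Suc)
  have alpha: "(\<lambda>k. \<alpha> p (Suc k) \<bullet> d (Suc k)) \<longlonglongrightarrow> 0"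
  proof -
    have B0: "(\<lambda>k. d (Suc k) \<bullet> (B (y (Suc k)) - B p)) \<longlonglongrightarrow> 0"
    proof (rule tendsto_inner_bounded_zero[OF d1])
      fix k
      have "y (Suc k) - p = 2 *\<^sub>R (x (Suc k) - p) - (x k - p)"
        by (simp add: y_Suc scaleR_diff_right scaleR_2)
      then have "norm (y (Suc k) - p) \<le> norm (2 *\<^sub>R (x (Suc k) - p)) + norm (x k - p)"
        by (metis norm_triangle_ineq4)
      then have "norm (y (Suc k) - p) \<le> 3 * (R + norm p)"
        using zR[of k] zR[of "Suc k"] by simp
      then show "norm (B (y (Suc k)) - B p) \<le> KB * (3 * (R + norm p))"
        using KB(2) by (intro order_trans[OF KB(1)] mult_left_mono) auto
    qed
    have C0: "(\<lambda>k. d (Suc k) \<bullet> (C (x (Suc k)) - C p)) \<longlonglongrightarrow> 0"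
    proof (rule tendsto_inner_bounded_zero[OF d1])
      show "norm (C (x (Suc k)) - C p) \<le> KC * (R + norm p)" for k
        using KC(2) zR[of "Suc k"] by (intro order_trans[OF KC(1)] mult_left_mono) auto
    qed
    have "(\<lambda>k. (- S (d (Suc k)) - u (Suc (Suc k)) + u (Suc k)) \<bullet> d (Suc k)
        - d (Suc k) \<bullet> (B (y (Suc k)) - B p) - d (Suc k) \<bullet> (C (x (Suc k)) - C p))
      \<longlonglongrightarrow> (- S 0 - 0 + 0) \<bullet> 0 - 0 - 0"
      by (intro tendsto_intros B0 C0 d1 tendsto[OF d1] LIMSEQ_Suc[OF u_tendsto_zero]
          LIMSEQ_Suc[OF LIMSEQ_Suc[OF u_tendsto_zero]])
    then show ?thesis by (simp add: \<alpha>_def inner_diff_left inner_diff_right inner_add_left inner_add_right inner_commute)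
  qed
  have u0: "(\<lambda>k. u (Suc (Suc k)) \<bullet> (x (Suc (Suc k)) - p)) \<longlonglongrightarrow> 0"
    using LIMSEQ_Suc[OF LIMSEQ_Suc[OF u_tendsto_zero]] zR by (rule tendsto_inner_bounded_zero)
  have L0: "(\<lambda>k. L k * (sq (d k) - sq (d (Suc k)))) \<longlonglongrightarrow> 0"
  proof (rule tendsto_zero_of_norm_le)
    show "(\<lambda>k. sq (d k) - sq (d (Suc k))) \<longlonglongrightarrow> 0"
      using tendsto_diff[OF sq0[OF d_tendsto_zero] sq0[OF d1]] by simp
    show "norm (L k * (sq (d k) - sq (d (Suc k)))) \<le> 1 * norm (sq (d k) - sq (d (Suc k)))" for k
      unfolding norm_mult using L_nonneg[of k] L_le_1[of k] by (intro mult_right_mono) auto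
  qed
  have "0 \<le> W p k" for k
    by (rule order_trans[OF _ W_lower]) simp
  then have "convergent (W p)"
    using W_descent[OF p] \<epsilon>
    by (intro descent_convergent(1)[of "W p" \<epsilon> "\<lambda>k. sq (d (Suc k)) + sq (e (Suc k))"]) auto
  then obtain w where w: "W p \<longlonglongrightarrow> w" by (auto simp: convergent_def)
  have "(\<lambda>k. W p k + 2 * (\<alpha> p (Suc k) \<bullet> d (Suc k)) - 2 * (u (Suc (Suc k)) \<bullet> (x (Suc (Suc k)) - p))
      - \<mu> * sq (e k) - L k * (sq (d k) - sq (d (Suc k)))) \<longlonglongrightarrow> w + 2 * 0 - 2 * 0 - \<mu> * 0 - 0"
    by (intro tendsto_intros w alpha u0 L0 sq0 e_tendsto_zero)
  then have "(\<lambda>k. sq (x (Suc (Suc k)) - p)) \<longlonglongrightarrow> w" by (simp add: W_def)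
  then have "(\<lambda>k. sq (x (Suc k) - p)) \<longlonglongrightarrow> w" by (rule LIMSEQ_imp_Suc)
  then have "(\<lambda>k. sq (x k - p)) \<longlonglongrightarrow> w" by (rule LIMSEQ_imp_Suc)
  then show ?thesis by (rule convergentI)
qed

text \<open>An element of the sum of the three operators at \<open>x (Suc k)\<close>. The increments
  of \<open>B\<close> and \<open>C\<close> in it are controlled by the extrapolation error and the
  step.\<close>

definition residual :: "nat \<Rightarrow> 'a" where
  "residual k = S (x k - x (Suc k)) - u (Suc k) + u k - B (y k) - C (x k) + (B (x (Suc k)) + C (x (Suc k)))"

lemma residual_tendsto_zero: "residual \<longlonglongrightarrow> 0"
proof -
  obtain KB where KB: "\<And>v w. norm (B v - B w) \<le> KB * norm (v - w)"
    using lipschitz_wrt_norm[OF lip_B] \<mu> by (meson less_imp_le)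
  obtain KC where KC: "\<And>v w. norm (C v - C w) \<le> KC * norm (v - w)"
    using lipschitz_wrt_norm[OF lip_C] \<beta> by (meson less_imp_le)
  have B0: "(\<lambda>k. B (x (Suc (Suc k))) - B (y (Suc k))) \<longlonglongrightarrow> 0"
  proof (rule tendsto_zero_of_norm_le[OF e_tendsto_zero])
    show "norm (B (x (Suc (Suc k))) - B (y (Suc k))) \<le> KB * norm (e k)" for k
      using KB[of "x (Suc (Suc k))" "y (Suc k)"] by (simp add: y_eq e_def d_def algebra_simps)
  qed
  have C0: "(\<lambda>k. C (x (Suc k)) - C (x k)) \<longlonglongrightarrow> 0"
  proof (rule tendsto_zero_of_norm_le[OF d_tendsto_zero])
    show "norm (C (x (Suc k)) - C (x k)) \<le> KC * norm (d k)" for k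
      using KC[of "x (Suc k)" "x k"] by (simp add: d_def)
  qed
  have "(\<lambda>k. - S (d (Suc k)) - u (Suc (Suc k)) + u (Suc k) + (B (x (Suc (Suc k))) - B (y (Suc k)))
      + (C (x (Suc (Suc k))) - C (x (Suc k)))) \<longlonglongrightarrow> - S 0 - 0 + 0 + 0 + 0"
    by (intro tendsto_intros B0 LIMSEQ_Suc[OF C0] tendsto[OF LIMSEQ_Suc[OF d_tendsto_zero]]
        LIMSEQ_Suc[OF u_tendsto_zero] LIMSEQ_Suc[OF LIMSEQ_Suc[OF u_tendsto_zero]])
  then have "(\<lambda>k. residual (Suc k)) \<longlonglongrightarrow> 0"
    by (simp add: residual_def d_def diff algebra_simps)
  then show ?thesis by (rule LIMSEQ_imp_Suc)
qed

lemma weak_cluster_point_is_zero: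
  assumes "G \<le> sequentially" "G \<noteq> bot" and l: "\<And>v. ((\<lambda>n. x n \<bullet> v) \<longlongrightarrow> l \<bullet> v) G"
  shows "- (B l + C l) \<in> A l"
proof -
  define F where "F v = B v + C v" for v
  obtain R where R: "\<And>k. norm (x k) \<le> R" using x_bounded by blast
  obtain KB where KB: "\<And>v w. norm (B v - B w) \<le> KB * norm (v - w)"
    using lipschitz_wrt_norm[OF lip_B] \<mu> by (meson less_imp_le)
  obtain KC where KC: "\<And>v w. norm (C v - C w) \<le> KC * norm (v - w)"
    using lipschitz_wrt_norm[OF lip_C] \<beta> by (meson less_imp_le)
  have lip: "norm (F v - F w) \<le> (KB + KC) * norm (v - w)" for v w
  proof -
    have "F v - F w = (B v - B w) + (C v - C w)" by (simp add: F_def)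
    then have "norm (F v - F w) \<le> norm (B v - B w) + norm (C v - C w)"
      by (metis norm_triangle_ineq)
    then show ?thesis using KB[of v w] KC[of v w] by (simp add: distrib_right)
  qed
  have "(F \<longlongrightarrow> F l) (at l)"
  proof (subst LIM_zero_iff[symmetric], rule tendsto_zero_of_norm_le[OF _ lip])
    show "((\<lambda>v. v - l) \<longlongrightarrow> 0) (at l)" by (simp add: LIM_zero_iff tendsto_ident_at)
  qed
  then have cont: "isCont F l" by (simp add: isCont_def)
  have monF: "monotone_op (\<lambda>z. {F z})"
  proof -
    have "0 \<le> (F v - F w) \<bullet> (v - w)" for v w
    proof -
      have "0 \<le> (B v - B w) \<bullet> (v - w)" using mono_B by (simp add: monotone_op_def)
      moreover have "0 \<le> 1 / \<beta> * (norm_wrt (inv S) (C v - C w))\<^sup>2" using \<beta> by simp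
      then have "0 \<le> (C v - C w) \<bullet> (v - w)"
        using coco_C unfolding cocoercive_wrt_def by (meson order_trans)
      ultimately show ?thesis by (simp add: F_def inner_diff_left inner_add_left)
    qed
    then show ?thesis by (simp add: monotone_op_def)
  qed
  have "norm (F (x n)) \<le> norm (F 0) + norm (KB + KC) * R" for n
  proof -
    have "norm (F (x n) - F 0) \<le> norm (KB + KC) * R"
      using lip[of "x n" 0] R[of n] by (smt (verit) mult_mono norm_ge_zero real_norm_def diff_0_right)
    then show ?thesis using norm_triangle_ineq2[of "F (x n)" "F 0"] by linarith
  qed
  \<comment> \<open>A further refinement makes \<open>F (x n)\<close> converge weakly as well; its
    limit \<open>f\<close> is not yet known to be \<open>F l\<close>.\<close>
  then obtain G' f where G': "G' \<le> G" "G' \<noteq> bot" and f: "\<And>v. ((\<lambda>n. F (x n) \<bullet> v) \<longlongrightarrow> f \<bullet> v) G'"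
    using bounded_weak_cluster_point[OF \<open>G \<noteq> bot\<close>, of "\<lambda>n. F (x n)"] by blast
  have G'_seq: "G' \<le> sequentially" using G'(1) assms(1) by (rule order_trans)
  \<comment> \<open>\<open>x n\<close> comes from step \<open>n - 1\<close>; the truncated value at
    \<open>n = 0\<close> is harmless, since membership is claimed from \<open>n = 1\<close>
    on.\<close>
  define a where "a n = residual (n - 1) - F (x n)" for n
  have "a (Suc k) \<in> A (x (Suc k))" for k
    using inclusion[of k] by (simp add: a_def residual_def F_def)
  then have "eventually (\<lambda>n. a n \<in> A (x n)) sequentially"
    by (intro eventually_sequentiallyI[of 1]) (metis One_nat_def Suc_le_D)
  then have a: "eventually (\<lambda>n. a n \<in> A (x n)) G'" using G'_seq by (rule filter_leD[rotated])
  have "(\<lambda>n. a n + F (x n)) \<longlonglongrightarrow> 0"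
    by (rule LIMSEQ_imp_Suc) (simp add: a_def residual_tendsto_zero)
  then have r: "((\<lambda>n. a n + F (x n)) \<longlongrightarrow> 0) G'" using G'_seq by (rule tendsto_mono[rotated])
  have "- F l \<in> A l"
    using monotone_sum_demiclosed[OF maxmon_A monF cont G'(2) _ f a r R] tendsto_mono[OF G'(1) l] by blast
  then show ?thesis by (simp add: F_def)
qed

text \<open>The distances to two zeros \<open>p\<close> and \<open>q\<close> converge, hence so does \<open>x n \<bullet> S (p - q)\<close> along the whole
  sequence; two weak cluster points therefore coincide (Opial).\<close>

lemma weak_convergence: "\<exists>p. - (B p + C p) \<in> A p \<and> weakly_converges x p"
proof -
  obtain R where R: "\<And>k. norm (x k) \<le> R" using x_bounded by blast
  obtain G p where G: "G \<le> sequentially" "G \<noteq> bot" and p: "\<And>v. ((\<lambda>n. x n \<bullet> v) \<longlongrightarrow> p \<bullet> v) G"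
    using bounded_weak_cluster_point[of sequentially x R, OF sequentially_bot R] by blast
  have zp: "- (B p + C p) \<in> A p" using weak_cluster_point_is_zero[OF G p] .
  have unique: "q = p"
    if H: "H \<le> sequentially" "H \<noteq> bot" and q: "\<And>v. ((\<lambda>n. x n \<bullet> v) \<longlongrightarrow> q \<bullet> v) H" for H q
  proof -
    have zq: "- (B q + C q) \<in> A q" using weak_cluster_point_is_zero[OF H q] .
    obtain w w' where "(\<lambda>n. sq (x n - p)) \<longlonglongrightarrow> w" "(\<lambda>n. sq (x n - q)) \<longlonglongrightarrow> w'"
      using sq_distance_convergent[OF zp] sq_distance_convergent[OF zq] by (auto simp: convergent_def)
    \<comment> \<open>Polarisation: the terms \<open>sq (x n)\<close> cancel and only a linear
      function of \<open>x n\<close> remains.\<close>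
    then have "(\<lambda>n. (sq (x n - q) - sq (x n - p) + sq p - sq q) / 2) \<longlonglongrightarrow> (w' - w + sq p - sq q) / 2"
      by (intro tendsto_intros) auto
    moreover have "(sq (x n - q) - sq (x n - p) + sq p - sq q) / 2 = x n \<bullet> S (p - q)" for n
    proof -
      have "sq (x n - r) = sq (x n) - 2 * (x n \<bullet> S r) + sq r" for r
        using sq_add[of "x n" "- r"] symmetric[of "x n" r] by (simp add: inner_commute[of "x n" "S r"])
      then show ?thesis by (simp add: diff inner_diff_right)
    qed
    ultimately have lim: "(\<lambda>n. x n \<bullet> S (p - q)) \<longlonglongrightarrow> (w' - w + sq p - sq q) / 2" by simp
    have "p \<bullet> S (p - q) = (w' - w + sq p - sq q) / 2"
      using tendsto_unique[OF G(2) p tendsto_mono[OF G(1) lim]] .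
    moreover have "q \<bullet> S (p - q) = (w' - w + sq p - sq q) / 2"
      using tendsto_unique[OF H(2) q tendsto_mono[OF H(1) lim]] .
    ultimately have "S (p - q) \<bullet> p - S (p - q) \<bullet> q = 0" by (simp add: inner_commute[of "S (p - q)"])
    then have "sq (p - q) = 0" by (simp only: sq_def inner_diff_right)
    then show ?thesis by (simp add: sq_eq_0_iff)
  qed
  have "weakly_converges x p"
    unfolding weakly_converges_def
  proof (intro allI tendstoI, rule ccontr)
    fix v and r :: real
    assume "0 < r"
    assume not: "\<not> eventually (\<lambda>n. dist (x n \<bullet> v) (p \<bullet> v) < r) sequentially"
    \<comment> \<open>If the limit fails for the test vector \<open>v\<close>, the bad indices carry
      a proper filter. A weak cluster point along it must again be \<open>p\<close>, contradicting
      the distance \<open>r\<close>.\<close>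
    define Fr where "Fr = inf sequentially (principal {n. \<not> dist (x n \<bullet> v) (p \<bullet> v) < r})"
    have "Fr \<noteq> bot"
      using not unfolding Fr_def trivial_limit_def eventually_inf_principal by simp
    obtain H q where H: "H \<le> Fr" "H \<noteq> bot" and q: "\<And>v. ((\<lambda>n. x n \<bullet> v) \<longlongrightarrow> q \<bullet> v) H"
      using bounded_weak_cluster_point[of Fr x R, OF \<open>Fr \<noteq> bot\<close> R] by blast
    have "H \<le> sequentially" using H(1) by (rule order_trans) (simp add: Fr_def)
    then have "q = p" by (rule unique[OF _ H(2) q])
    then have "eventually (\<lambda>n. dist (x n \<bullet> v) (p \<bullet> v) < r) H"
      using q \<open>0 < r\<close> by (simp add: tendsto_iff)
    moreover have "eventually (\<lambda>n. \<not> dist (x n \<bullet> v) (p \<bullet> v) < r) H"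
      using H(1) by (rule filter_leD) (simp add: Fr_def eventually_inf_principal)
    ultimately have "eventually (\<lambda>_. False) H" by eventually_elim simp
    then show False using H(2) by (simp add: trivial_limit_def)
  qed
  then show ?thesis using zp by blast
qed

end

section \<open>Scaling\<close>

context metric_operator
begin

lemma lipschitz_wrt_scaleR:
  assumes "lipschitz_wrt S L T" "0 \<le> t"
  shows "lipschitz_wrt S (t * L) (\<lambda>z. t *\<^sub>R T z)"
  unfolding lipschitz_wrt_def
proof (intro allI)
  fix v w
  have "norm_wrt (inv S) (t *\<^sub>R T v - t *\<^sub>R T w) = t * norm_wrt (inv S) (T v - T w)"
    using norm_wrt_inv_scaleR[OF assms(2), of "T v - T w"] by (simp add: scaleR_diff_right)
  also have "\<dots> \<le> t * (L * norm_wrt S (v - w))"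
    using assms by (intro mult_left_mono) (auto simp: lipschitz_wrt_def)
  finally show "norm_wrt (inv S) (t *\<^sub>R T v - t *\<^sub>R T w) \<le> t * L * norm_wrt S (v - w)"
    by (simp add: mult.assoc)
qed

lemma cocoercive_wrt_scaleR:
  assumes "cocoercive_wrt S (1 / \<beta>) T" "0 < t"
  shows "cocoercive_wrt S (1 / (t * \<beta>)) (\<lambda>z. t *\<^sub>R T z)"
  unfolding cocoercive_wrt_def
proof (intro allI)
  fix v w
  have "norm_wrt (inv S) (t *\<^sub>R T v - t *\<^sub>R T w) = t * norm_wrt (inv S) (T v - T w)"
    using norm_wrt_inv_scaleR[of t "T v - T w"] \<open>0 < t\<close> by (simp add: scaleR_diff_right)
  then have "1 / (t * \<beta>) * (norm_wrt (inv S) (t *\<^sub>R T v - t *\<^sub>R T w))\<^sup>2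
      = t * (1 / \<beta> * (norm_wrt (inv S) (T v - T w))\<^sup>2)"
    using \<open>0 < t\<close> by (simp add: power2_eq_square)
  also have "\<dots> \<le> t * ((T v - T w) \<bullet> (v - w))"
    using assms(1) less_imp_le[OF \<open>0 < t\<close>] unfolding cocoercive_wrt_def by (blast intro: mult_left_mono)
  also have "\<dots> = (t *\<^sub>R T v - t *\<^sub>R T w) \<bullet> (v - w)"
    by (simp flip: scaleR_diff_right)
  finally show "1 / (t * \<beta>) * (norm_wrt (inv S) (t *\<^sub>R T v - t *\<^sub>R T w))\<^sup>2
      \<le> (t *\<^sub>R T v - t *\<^sub>R T w) \<bullet> (v - w)" .
qed

end

lemma monotone_op_scaleR:
  assumes "monotone_op T" "0 \<le> t"
  shows "monotone_op (\<lambda>z. (*\<^sub>R) t ` T z)"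
  using assms unfolding monotone_op_def by (auto simp flip: scaleR_diff_right)

text \<open>A monotone extension of the scaled operator, rescaled by \<open>1 / t\<close>, extends
  \<open>A\<close> and so equals it.\<close>

lemma maximally_monotone_scaleR:
  assumes A: "maximally_monotone A" and "0 < t"
  shows "maximally_monotone (\<lambda>z. (*\<^sub>R) t ` A z)"
  unfolding maximally_monotone_def
proof (intro conjI allI impI)
  show "monotone_op (\<lambda>z. (*\<^sub>R) t ` A z)"
    using A \<open>0 < t\<close> by (intro monotone_op_scaleR) (auto simp: maximally_monotone_def)
  fix T assume T: "monotone_op T \<and> (\<forall>z. (*\<^sub>R) t ` A z \<subseteq> T z)"
  have cancel: "(*\<^sub>R) t ` (*\<^sub>R) (1 / t) ` X = X" "(*\<^sub>R) (1 / t) ` (*\<^sub>R) t ` X = X" for X :: "'a set"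
    using \<open>0 < t\<close> by (auto simp: image_image)
  have "monotone_op (\<lambda>z. (*\<^sub>R) (1 / t) ` T z)"
    using T \<open>0 < t\<close> by (intro monotone_op_scaleR) auto
  moreover have "A z \<subseteq> (*\<^sub>R) (1 / t) ` T z" for z
    using T image_mono[of "(*\<^sub>R) t ` A z" "T z" "(*\<^sub>R) (1 / t)"] cancel(2) by metis
  ultimately have "(\<lambda>z. (*\<^sub>R) (1 / t) ` T z) = A"
    using A unfolding maximally_monotone_def by blast
  then have "(*\<^sub>R) (1 / t) ` T z = A z" for z by metis
  then show "T = (\<lambda>z. (*\<^sub>R) t ` A z)" using cancel(1) by metis
qed

lemma mem_zer_sum_iff: "z \<in> zer (\<lambda>z. A z + {B z} + {C z}) \<longleftrightarrow> - (B z + C z) \<in> A z"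
  for z :: "'a::ab_group_add"
proof -
  have "a + b + c = 0 \<longleftrightarrow> a = - (b + c)" for a b c :: 'a
    by (simp only: add.assoc eq_neg_iff_add_eq_0)
  then show ?thesis by (auto simp: zer_def set_plus_def simp del: minus_add_distrib)
qed

theorem theorem3p3:
  fixes S B C :: "'a::{real_inner, complete_space} \<Rightarrow> 'a"
    and A :: "'a \<Rightarrow> 'a set"
    and M :: "nat \<Rightarrow> 'a \<Rightarrow> 'a"
    and L :: "nat \<Rightarrow> real"
    and \<gamma> \<mu> \<beta> \<epsilon>\<^sub>2 :: real
    and x_init :: 'a  \<comment> \<open>the point with index -1\<close>
    and x y u :: "nat \<Rightarrow> 'a"
  assumes "bounded_linear S" "self_adjoint S" "strongly_monotone S"
    and "maximally_monotone A"
    and "monotone_op (\<lambda>z. {B z})" "\<mu> > 0" "lipschitz_wrt S \<mu> B"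
    and "\<beta> > 0" "cocoercive_wrt S (1 / \<beta>) C"
    and "zer (\<lambda>z. A z + {B z} + {C z}) \<noteq> {}"
    and "\<gamma> > 0"
    and "\<And>k. 0 \<le> L k \<and> L k < 1"
    and "\<And>k. lipschitz_wrt S (L k) (\<lambda>z. \<gamma> *\<^sub>R M k z - S z)"
    and "\<epsilon>\<^sub>2 > 0"
    and "y 0 = 2 *\<^sub>R x 0 - x_init"
    and "\<And>k. y (Suc k) = 2 *\<^sub>R x (Suc k) - x k"
    and "\<And>k. x (Suc k) \<in> inv_op (\<lambda>z. {M k z} + A z)
                 (M k (x k) - B (y k) - C (x k) + (1 / \<gamma>) *\<^sub>R u k)"
    and "\<And>k. u (Suc k) = (\<gamma> *\<^sub>R M k (x (Suc k)) - S (x (Suc k)))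
                        - (\<gamma> *\<^sub>R M k (x k) - S (x k))"
    and "\<exists>\<epsilon>>0.
          (\<forall>k\<ge>1. 1 - 3 * L k - (2 + \<epsilon>\<^sub>2 + 2 * \<epsilon>\<^sub>2\<^sup>2) * \<gamma> * \<beta> / (2 * \<epsilon>\<^sub>2)
                    - L (k - 1) - \<gamma> * \<mu> * (sqrt 2 + 1) \<ge> \<epsilon>) \<and>
          (\<forall>k\<ge>2. 1 - L (k - 1) - L (k - 2) - \<gamma> * \<mu> * (sqrt 2 + 1) \<ge> \<epsilon>)"
  shows "\<exists>x'. x' \<in> zer (\<lambda>z. A z + {B z} + {C z}) \<and> weakly_converges x x'"
proof -
  interpret metric_operator S using assms(1-3) by (rule metric_operator.intro)
  have C_sc: "cocoercive_wrt S (1 / (\<gamma> * \<beta>)) (\<lambda>z. \<gamma> *\<^sub>R C z)"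
    using assms(9,11) by (rule cocoercive_wrt_scaleR)
  have B_sc: "lipschitz_wrt S (\<gamma> * \<mu>) (\<lambda>z. \<gamma> *\<^sub>R B z)"
    using assms(7,11) by (intro lipschitz_wrt_scaleR) auto
  have B_mono: "monotone_op (\<lambda>z. {\<gamma> *\<^sub>R B z})"
    using monotone_op_scaleR[OF assms(5), of \<gamma>] assms(11) by simp
  have A_max: "maximally_monotone (\<lambda>z. (*\<^sub>R) \<gamma> ` A z)"
    using assms(4,11) by (rule maximally_monotone_scaleR)
  have scaled_zero: "- (\<gamma> *\<^sub>R B z + \<gamma> *\<^sub>R C z) \<in> (*\<^sub>R) \<gamma> ` A z \<longleftrightarrow> - (B z + C z) \<in> A z" for z
  proof -
    have "- (\<gamma> *\<^sub>R B z + \<gamma> *\<^sub>R C z) = \<gamma> *\<^sub>R (- (B z + C z))"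
      by (simp add: scaleR_add_right scaleR_diff_right)
    then show ?thesis using assms(11) by (simp only: image_iff scaleR_cancel_left) auto
  qed
  have incl: "S (x k - x (Suc k)) - u (Suc k) + u k - \<gamma> *\<^sub>R B (y k) - \<gamma> *\<^sub>R C (x k)
      \<in> (*\<^sub>R) \<gamma> ` A (x (Suc k))" for k
  proof -
    obtain a where a: "a \<in> A (x (Suc k))"
      "M k (x k) - B (y k) - C (x k) + (1 / \<gamma>) *\<^sub>R u k = M k (x (Suc k)) + a"
      using assms(17)[of k] by (auto simp: inv_op_def set_plus_def)
    have "a = M k (x k) - B (y k) - C (x k) + (1 / \<gamma>) *\<^sub>R u k - M k (x (Suc k))"
      using a(2) by (simp add: algebra_simps)
    \<comment> \<open>By the update of \<open>u\<close>, \<open>\<gamma>\<close> times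
      \<open>M k (x k) - M k (x (Suc k))\<close> equals
      \<open>S (x k - x (Suc k)) - u (Suc k)\<close>.\<close>
    then have "\<gamma> *\<^sub>R a = S (x k - x (Suc k)) - u (Suc k) + u k - \<gamma> *\<^sub>R B (y k) - \<gamma> *\<^sub>R C (x k)"
      using assms(11) by (simp add: assms(18) diff scaleR_diff_right scaleR_add_right)
    then show ?thesis using a(1) by (metis imageI)
  qed
  obtain \<epsilon> where "\<epsilon> > 0" and \<epsilon>: "\<And>k. k \<ge> 1 \<Longrightarrow>
      1 - 3 * L k - (2 + \<epsilon>\<^sub>2 + 2 * \<epsilon>\<^sub>2\<^sup>2) * \<gamma> * \<beta> / (2 * \<epsilon>\<^sub>2) - L (k - 1) - \<gamma> * \<mu> * (sqrt 2 + 1) \<ge> \<epsilon>"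
    using assms(19) by blast
  have "5 / 2 * (\<gamma> * \<beta>) \<le> (2 + \<epsilon>\<^sub>2 + 2 * \<epsilon>\<^sub>2\<^sup>2) * \<gamma> * \<beta> / (2 * \<epsilon>\<^sub>2)"
  proof -
    \<comment> \<open>The minimum over \<open>\<epsilon>\<^sub>2\<close> of
      \<open>1 / \<epsilon>\<^sub>2 + 1 / 2 + \<epsilon>\<^sub>2\<close> is \<open>5 / 2\<close>,
      attained at 1.\<close>
    have "0 \<le> 2 * (\<epsilon>\<^sub>2 - 1)\<^sup>2" by simp
    then have "5 / 2 * (2 * \<epsilon>\<^sub>2) \<le> 2 + \<epsilon>\<^sub>2 + 2 * \<epsilon>\<^sub>2\<^sup>2" by (simp add: power2_diff)
    then have "5 / 2 \<le> (2 + \<epsilon>\<^sub>2 + 2 * \<epsilon>\<^sub>2\<^sup>2) / (2 * \<epsilon>\<^sub>2)"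
      using assms(14) by (subst pos_le_divide_eq) auto
    then have "5 / 2 * (\<gamma> * \<beta>) \<le> (2 + \<epsilon>\<^sub>2 + 2 * \<epsilon>\<^sub>2\<^sup>2) / (2 * \<epsilon>\<^sub>2) * (\<gamma> * \<beta>)"
      using assms(8,11) by (intro mult_right_mono) auto
    then show ?thesis by simp
  qed
  then have par: "\<epsilon> \<le> 1 - 3 * L (Suc k) - L k - 5 / 2 * (\<gamma> * \<beta>) - \<gamma> * \<mu> * (sqrt 2 + 1)" for k
    using \<epsilon>[of "Suc k"] by simp
  have u_bound: "norm_wrt (inv S) (u (Suc k)) \<le> L k * norm_wrt S (x (Suc k) - x k)" for k
    using assms(13)[of k] by (simp add: lipschitz_wrt_def assms(18))
  obtain p where "- (B p + C p) \<in> A p" using assms(10) by (auto simp: mem_zer_sum_iff)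
  then have "\<exists>p. - (\<gamma> *\<^sub>R B p + \<gamma> *\<^sub>R C p) \<in> (*\<^sub>R) \<gamma> ` A p"
    unfolding scaled_zero by blast
  then interpret reflected_iteration S "\<lambda>z. (*\<^sub>R) \<gamma> ` A z" "\<lambda>z. \<gamma> *\<^sub>R B z" "\<lambda>z. \<gamma> *\<^sub>R C z"
    x y u L "\<gamma> * \<mu>" "\<gamma> * \<beta>" \<epsilon>
    using A_max B_mono B_sc C_sc incl par u_bound \<open>\<epsilon> > 0\<close> assms(6,8,11,12,16)
    by unfold_locales auto
  show ?thesis
    using weak_convergence unfolding scaled_zero mem_zer_sum_iff .
qed

end
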